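(* Let $p>1$, let $a<b$ be real numbers, and let $W\in C^{1,1}_{loc}(\mathbb{R})$ be a potential such that $W'(a)=W'(b)=0$, $W'<0$ on $(a,b)$, and $$W'(u)\ge -c(u-a)^p\quad\text{for all } u\in[a,b],$$ for a constant $c>0$. Then for all sufficiently small $\lambda,\epsilon>0$ (i.e. there exist $\lambda_0,\epsilon_0>0$, depending on $W$, such that for all $\lambda\in(0,\lambda_0)$ and $\epsilon\in(0,\epsilon_0)$) the following holds. Let $\psi\in C^\infty(\mathbb{R})$ be a positive function such that $\psi(s)=\lambda|s|$ for $|s|>\epsilon$, and let $D=\{x=(x_1,x_2)\in\mathbb{R}^2:\ |x_2|<\psi(x_1)\}$. Then there exists a solution $u\in C^2(D)$ of $\Delta u=W'(u)$ in $D$ such that $u(D)\subset(a,b)$ and $$\lim_{x_1\to+\infty}u(x)=a\quad\text{and}\quad\lim_{x_1\to-\infty}u(x)=b .$$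
   Context: The limits are taken over $x=(x_1,x_2)\in D$ and are uniform in $x_2$: e.g. $\lim_{x_1\to+\infty}u(x)=a$ means that for every $\eta>0$ there is $M$ such that $|u(x)-a|<\eta$ for all $x\in D$ with $x_1>M$. *)

theory Defs
  imports "HOL-Analysis.Analysis"
begin

definition partial_diff ::
  "'a::euclidean_space \<Rightarrow> ('a \<Rightarrow> real) \<Rightarrow> 'a \<Rightarrow> real" where
  "partial_diff e f x = deriv (\<lambda>t. f (x + t *\<^sub>R e)) 0"

(* All iterated partial derivatives of f of order at most k exist and are continuous on S.
   Only used for open S, where the values of partial_diff e f on S depend only on f restricted
   to S, and where this is the usual class C^k(S). *)
fun C_diff_on :: "nat \<Rightarrow> 'a::euclidean_space set \<Rightarrow> ('a \<Rightarrow> real) \<Rightarrow> bool" where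
  "C_diff_on 0 S f \<longleftrightarrow> continuous_on S f"
| "C_diff_on (Suc k) S f \<longleftrightarrow>
     continuous_on S f \<and>
     (\<forall>e\<in>Basis. (\<forall>x\<in>S. (\<lambda>t. f (x + t *\<^sub>R e)) differentiable at 0) \<and>
                C_diff_on k S (partial_diff e f))"

definition C_infinity_on :: "'a::euclidean_space set \<Rightarrow> ('a \<Rightarrow> real) \<Rightarrow> bool" where
  "C_infinity_on S f \<longleftrightarrow> (\<forall>k. C_diff_on k S f)"

definition laplacian :: "('a::euclidean_space \<Rightarrow> real) \<Rightarrow> 'a \<Rightarrow> real" where
  "laplacian f x = (\<Sum>e\<in>Basis. partial_diff e (partial_diff e f) x)"

(* The class C^{1,1}_loc(R); continuity of the derivative follows from the Lipschitz bounds. *)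
definition C11_loc :: "(real \<Rightarrow> real) \<Rightarrow> bool" where
  "C11_loc W \<longleftrightarrow>
     (\<forall>x. W differentiable at x) \<and>
     (\<forall>K. compact K \<longrightarrow> (\<exists>L. L-lipschitz_on K (deriv W)))"

definition profile_domain :: "(real \<Rightarrow> real) \<Rightarrow> (real ^ 2) set" where
  "profile_domain \<psi> = {x. \<bar>x $ 2\<bar> < \<psi> (x $ 1)}"

end

theory Submission
  imports Defs "HOL-Probability.Distributions"
begin

text \<open>
  No boundary condition is imposed on the solution, so the problem may be extended to the whole
  plane as \<open>\<Delta>u = F(x, u)\<close> with \<open>F(x, s) = W'(s) + A(x)(s - a) - B(x)(b - s)\<close>, where \<open>A, B \<ge> 0\<close>
  vanish on \<open>D\<close> and act to the right and to the left of it.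
  With \<open>\<sigma> = 2/(p - 1)\<close>, the function \<open>a + min (b - a) (x\<^sub>1\<^sup>-\<^sup>\<sigma> (1 + 1/(1 + \<beta> x\<^sub>2\<^sup>2/x\<^sub>1\<^sup>2)))\<close>, extended by \<open>b\<close> to the left,
  is a supersolution: for large \<open>\<beta>\<close> the concavity in \<open>x\<^sub>2\<close> on the thin cone beats both \<open>\<partial>\<^sub>1\<^sup>2\<close> and the
  bound \<open>c(u - a)\<^sup>p\<close>, which has the same homogeneity \<open>-\<sigma> - 2\<close>; off the cone the term \<open>A\<close> helps.
  Its mirror image gives a subsolution, because \<open>W' \<le> 0\<close>.

  A solution in between is a fixed point of the monotone map \<open>u \<mapsto> (k - \<Delta>)\<^sup>-\<^sup>1(k u - F(x, u))\<close> on a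
  complete lattice of Lipschitz functions. The resolvent is the Laplace transform of the heat semigroup,
  and Gaussian averages make it \<open>C\<^sup>2\<close> on Lipschitz data.
\<close>

section \<open>Gaussian averages\<close>

text \<open>The thresholds are \<open>l0 = l'\<close> and \<open>\<epsilon>0 = X0\<close>. The upper
  barrier equals \<open>b\<close> for \<open>x1 \<le> X0\<close> and the lower one equals
  \<open>a\<close> for \<open>x1 \<ge> - X0\<close>, so over the rounded middle, where |x1| \<le>
  \<epsilon>, both are constant. Beyond \<open>X0\<close> the domain is an exact cone of slope
  \<open>l < l'\<close>, and the gaps \<open>\<epsilon> < X0\<close> and \<open>l < l'\<close> leave
  room for Lipschitz cut-offs. The cap by \<open>b - a\<close> makes the barrier a minimum of smooth
  functions with a concave corner; hence the one-sided \<open>laplacian_le\<close> in place of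
  derivatives. It is only ever tested against resolvents, which have genuine second derivatives. A
  lattice fixed point needs no passage to the limit in the equation, but the class must be closed
  under pointwise suprema and infima, which continuous or C^2 functions are not. Functions with one
  fixed Lipschitz constant are, and the class is invariant because the gradient of a resolvent is
  controlled by the sup norm of the data alone. Lipschitz data are also just enough for second
  derivatives: the kernel \<open>gauss2\<close> has mean zero, which gains a factor \<open>r\<close>
  against the singular \<open>1 / r\<close>.\<close>

lemma has_real_derivative_integral_dominated:
  fixes H :: "real \<Rightarrow> 'b \<Rightarrow> real"
  assumes d: "d > 0"
    and int: "\<And>s. \<bar>s - s0\<bar> < d \<Longrightarrow> integrable M (H s)"
    and deriv: "\<And>s \<omega>. \<bar>s - s0\<bar> < d \<Longrightarrow> \<omega> \<in> space M \<Longrightarrow>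
      ((\<lambda>s. H s \<omega>) has_real_derivative H' s \<omega>) (at s)"
    and bound: "\<And>s \<omega>. \<bar>s - s0\<bar> < d \<Longrightarrow> \<omega> \<in> space M \<Longrightarrow> \<bar>H' s \<omega>\<bar> \<le> B \<omega>"
    and B: "integrable M B"
    and meas: "H' s0 \<in> borel_measurable M"
  shows "((\<lambda>s. \<integral>\<omega>. H s \<omega> \<partial>M) has_real_derivative (\<integral>\<omega>. H' s0 \<omega> \<partial>M)) (at s0)"
  unfolding DERIV_def tendsto_at_iff_sequentially comp_def
proof (intro allI impI)
  fix X :: "nat \<Rightarrow> real"
  assume X0: "\<forall>i. X i \<in> UNIV - {0}" and X: "X \<longlonglongrightarrow> 0"
  from order_tendstoD(2)[OF tendsto_rabs[OF X], of d] d
  \<comment> \<open>The hypotheses hold only within distance \<open>d\<close> of \<open>s0\<close>,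
    so the quotients are taken along a tail of the sequence.\<close>
  obtain N where N: "\<And>i. i \<ge> N \<Longrightarrow> \<bar>X i\<bar> < d"
    by (auto simp: eventually_sequentially)
  let ?Q = "\<lambda>i \<omega>. (H (s0 + X (i + N)) \<omega> - H s0 \<omega>) / X (i + N)"
  have XN: "\<bar>X (i + N)\<bar> < d" "X (i + N) \<noteq> 0" for i using N X0 by auto
  have "(\<lambda>i. \<integral>\<omega>. ?Q i \<omega> \<partial>M) \<longlonglongrightarrow> (\<integral>\<omega>. H' s0 \<omega> \<partial>M)"
  proof (rule integral_dominated_convergence[where w = B])
    show "H' s0 \<in> borel_measurable M" by fact
    show "integrable M B" by fact
    fix i
    have "integrable M (H (s0 + X (i + N)))" "integrable M (H s0)"
      using int XN[of i] d by auto
    then show "?Q i \<in> borel_measurable M" by (auto dest!: borel_measurable_integrable)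
    show "AE \<omega> in M. norm (?Q i \<omega>) \<le> B \<omega>"
    proof (rule AE_I2)
      fix \<omega> assume w: "\<omega> \<in> space M"
      let ?x = "X (i + N)"
      have "\<bar>H (s0 + ?x) \<omega> - H s0 \<omega>\<bar> \<le> B \<omega> * \<bar>(s0 + ?x) - s0\<bar>"
      proof (rule field_differentiable_bound[where S = "ball s0 d" and f' = "\<lambda>s. H' s \<omega>", unfolded real_norm_def])
        show "((\<lambda>s. H s \<omega>) has_field_derivative H' z \<omega>) (at z within ball s0 d)"
          if "z \<in> ball s0 d" for z
          using deriv[of z \<omega>] that w by (auto simp: dist_real_def abs_minus_commute intro: has_field_derivative_at_within)
        show "\<bar>H' z \<omega>\<bar> \<le> B \<omega>" if "z \<in> ball s0 d" for z
          using bound[of z \<omega>] that w by (auto simp: dist_real_def abs_minus_commute)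
      qed (use XN[of i] d in \<open>auto simp: dist_real_def\<close>)
      then show "norm (?Q i \<omega>) \<le> B \<omega>"
        using XN[of i] by (simp add: divide_simps)
    qed
  next
    show "AE \<omega> in M. (\<lambda>i. ?Q i \<omega>) \<longlonglongrightarrow> H' s0 \<omega>"
    proof (rule AE_I2)
      fix \<omega> assume w: "\<omega> \<in> space M"
      have "((\<lambda>s. H s \<omega>) has_real_derivative H' s0 \<omega>) (at s0)"
        using deriv[of s0 \<omega>] d w by auto
      then have "(\<lambda>h. (H (s0 + h) \<omega> - H s0 \<omega>) / h) \<midarrow>0\<rightarrow> H' s0 \<omega>"
        by (simp add: DERIV_def)
      moreover have "(\<lambda>i. X (i + N)) \<longlonglongrightarrow> 0"
        using X by (rule LIMSEQ_ignore_initial_segment)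
      ultimately show "(\<lambda>i. ?Q i \<omega>) \<longlonglongrightarrow> H' s0 \<omega>"
        using XN unfolding tendsto_at_iff_sequentially comp_def by auto
    qed
  qed
  moreover have eq: "(\<integral>\<omega>. ?Q i \<omega> \<partial>M) = ((\<integral>\<omega>. H (s0 + X (i + N)) \<omega> \<partial>M) - (\<integral>\<omega>. H s0 \<omega> \<partial>M)) / X (i + N)" for i
    using int[of "s0 + X (i + N)"] int[of s0] XN[of i] d by simp
  ultimately have "(\<lambda>i. ((\<integral>\<omega>. H (s0 + X (i + N)) \<omega> \<partial>M) - (\<integral>\<omega>. H s0 \<omega> \<partial>M)) / X (i + N))
      \<longlonglongrightarrow> (\<integral>\<omega>. H' s0 \<omega> \<partial>M)"
    unfolding eq by simp
  then show "(\<lambda>i. ((\<integral>\<omega>. H (s0 + X i) \<omega> \<partial>M) - (\<integral>\<omega>. H s0 \<omega> \<partial>M)) / X i) \<longlonglongrightarrow> (\<integral>\<omega>. H' s0 \<omega> \<partial>M)"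
    by (rule LIMSEQ_offset[of "\<lambda>i. ((\<integral>\<omega>. H (s0 + X i) \<omega> \<partial>M) - (\<integral>\<omega>. H s0 \<omega> \<partial>M)) / X i" N])
qed

text \<open>The Gaussian factors over the coordinates, so its integral is a power of the
  one-dimensional one, whose integrand is a multiple of the normal density of variance
  \<open>1 / (2 * c)\<close>.\<close>

lemma integrable_gaussian:
  assumes "c > 0"
  shows "integrable lborel (\<lambda>z :: 'a::euclidean_space. exp (- c * (z \<bullet> z)))"
proof (rule integrableI_bounded)
  have 1: "integrable lborel (\<lambda>x::real. exp (- c * x\<^sup>2))"
  proof -
    have "integrable lborel (\<lambda>x::real. sqrt (2 * pi * (sqrt (1 / (2 * c)))\<^sup>2) * normal_density 0 (sqrt (1 / (2 * c))) x)"
      using assms by (intro integrable_mult_right integrable_normal_density) simp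
    also have "(\<lambda>x::real. sqrt (2 * pi * (sqrt (1 / (2 * c)))\<^sup>2) * normal_density 0 (sqrt (1 / (2 * c))) x)
      = (\<lambda>x::real. exp (- c * x\<^sup>2))"
    proof
      have "(sqrt (1 / (2 * c)))\<^sup>2 = 1 / (2 * c)" using assms by simp
      then show "sqrt (2 * pi * (sqrt (1 / (2 * c)))\<^sup>2) * normal_density 0 (sqrt (1 / (2 * c))) x
          = exp (- c * x\<^sup>2)" for x
        using assms by (simp add: normal_density_def)
    qed
    finally show ?thesis .
  qed
  have "exp (- c * (z \<bullet> z)) = (\<Prod>b\<in>Basis. exp (- c * (z \<bullet> b)\<^sup>2))" for z :: 'a
    unfolding euclidean_inner[of z z]
    by (simp add: sum_distrib_left exp_sum power2_eq_square)
  then have "(\<integral>\<^sup>+z. ennreal (norm (exp (- c * ((z::'a) \<bullet> z)))) \<partial>lborel)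
      = (\<integral>\<^sup>+z. (\<Prod>b\<in>Basis. ennreal (exp (- c * ((z::'a) \<bullet> b)\<^sup>2))) \<partial>lborel)"
    by (simp add: prod_ennreal abs_prod)
  also have "\<dots> = (\<Prod>b\<in>(Basis::'a set). (\<integral>\<^sup>+x. ennreal (exp (- c * x\<^sup>2)) \<partial>lborel))"
    by (subst nn_integral_lborel_prod) auto
  also have "\<dots> < \<infinity>"
    using integrableD(2)[OF 1] by (auto simp: less_top[symmetric] ennreal_prod_eq_top power_eq_top_ennreal)
  finally show "(\<integral>\<^sup>+z. ennreal (norm (exp (- c * (z \<bullet> (z::'a))))) \<partial>lborel) < \<infinity>" .
qed measurable

lemma lborel_integral_affine:
  fixes f :: "'a::euclidean_space \<Rightarrow> real"
  assumes "c \<noteq> 0" and [measurable]: "f \<in> borel_measurable borel"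
  shows "(\<integral>z. f z \<partial>lborel) = \<bar>c\<bar> ^ DIM('a) * (\<integral>z. f (t + c *\<^sub>R z) \<partial>lborel)"
  by (subst lborel_affine[OF assms(1), of t])
    (simp add: integral_density integral_distr)

text \<open>The standard normal density. Normalising by the integral itself, instead of by its
  closed form, means that only the positivity of that integral has to be proved.\<close>

definition gauss :: "'a::euclidean_space \<Rightarrow> real" where
  "gauss z = exp (- (z \<bullet> z) / 2) / (\<integral>y. exp (- ((y::'a) \<bullet> y) / 2) \<partial>lborel)"

text \<open>The rate 1/4 is deliberately weaker than the rate 1/2 of \<open>gauss\<close>: the
  difference absorbs polynomial factors, so that one class contains \<open>gauss\<close> and all its
  differentiated kernels.\<close>

definition gaussian_decay :: "real \<Rightarrow> ('a::euclidean_space \<Rightarrow> real) \<Rightarrow> bool" where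
  "gaussian_decay C \<phi> \<longleftrightarrow> continuous_on UNIV \<phi> \<and> (\<forall>z. \<bar>\<phi> z\<bar> \<le> C * exp (- (z \<bullet> z) / 4))"

lemma integrable_gaussian':
  assumes "c > 0"
  shows "integrable lborel (\<lambda>z :: 'a::euclidean_space. exp (- (z \<bullet> z) / c))"
  using integrable_gaussian[of "1 / c", where 'a = 'a] assms by simp

lemma gauss_mass_pos: "(\<integral>y. exp (- ((y::'a::euclidean_space) \<bullet> y) / 2) \<partial>lborel) > 0"
proof -
  let ?f = "\<lambda>y::'a. exp (- (y \<bullet> y) / 2)"
  have "(\<integral>y. ?f y \<partial>lborel) \<noteq> 0"
  proof
    assume "(\<integral>y. ?f y \<partial>lborel) = 0"
    then have "AE y in lborel. ?f y = 0"
      by (subst (asm) integral_nonneg_eq_0_iff_AE[OF integrable_gaussian'[of 2]]) auto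
    then have "AE y in (lborel :: 'a measure). False" by simp
    then show False by (simp add: ae_filter_eq_bot_iff)
  qed
  moreover have "(\<integral>y. ?f y \<partial>lborel) \<ge> 0" by simp
  ultimately show ?thesis by linarith
qed

lemma gauss_pos: "gauss (z::'a::euclidean_space) > 0"
  using gauss_mass_pos[where 'a = 'a] by (simp add: gauss_def)

lemma gauss_neq_0 [simp]: "gauss z \<noteq> 0"
  using gauss_pos[of z] by simp

lemma integral_gauss: "(\<integral>z. gauss (z::'a::euclidean_space) \<partial>lborel) = 1"
  using gauss_mass_pos[where 'a = 'a] unfolding gauss_def by simp

lemma continuous_gauss: "continuous_on S (gauss :: 'a::euclidean_space \<Rightarrow> real)"
  unfolding gauss_def using gauss_mass_pos[where 'a = 'a] by (auto intro!: continuous_intros)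

lemma gaussian_decay_integrable:
  assumes "gaussian_decay C \<phi>"
  shows "integrable lborel \<phi>"
proof (rule Bochner_Integration.integrable_bound)
  show "integrable lborel (\<lambda>z::'a. C * exp (- (z \<bullet> z) / 4))"
    by (intro integrable_mult_right integrable_gaussian') simp
  show "\<phi> \<in> borel_measurable lborel"
    using assms by (auto simp: gaussian_decay_def intro: borel_measurable_continuous_onI)
  show "AE z in lborel. norm (\<phi> z) \<le> norm (C * exp (- (z \<bullet> z) / 4))"
    using assms by (auto simp: gaussian_decay_def intro: order_trans[OF _ abs_ge_self])
qed

lemma gaussian_decay_measurable: "gaussian_decay C \<phi> \<Longrightarrow> \<phi> \<in> borel_measurable borel"
  by (auto simp: gaussian_decay_def intro: borel_measurable_continuous_onI)

lemma gaussian_decay_nonneg: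
  assumes "gaussian_decay C \<phi>" shows "C \<ge> 0"
proof -
  have "\<bar>\<phi> 0\<bar> \<le> C" using assms unfolding gaussian_decay_def by (auto dest: spec[of _ 0])
  then show ?thesis by linarith
qed

text \<open>Half of the exponent of \<open>gauss\<close> pays for the polynomial, through
  \<open>1 + t \<le> exp t\<close> at \<open>t = (z \<bullet> z) / 4\<close>.\<close>

lemma gaussian_decay_poly:
  fixes p :: "'a::euclidean_space \<Rightarrow> real"
  assumes "continuous_on UNIV p" and p: "\<And>z. \<bar>p z\<bar> \<le> K * (1 + (z \<bullet> z) / 4)"
  shows "\<exists>C. gaussian_decay C (\<lambda>z. p z * gauss z)"
proof -
  let ?N = "\<integral>y. exp (- ((y::'a) \<bullet> y) / 2) \<partial>lborel"
  have K: "K \<ge> 0" using p[of 0] by simp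
  have "gaussian_decay (K / ?N) (\<lambda>z. p z * gauss z)"
    unfolding gaussian_decay_def
  proof (intro conjI allI)
    show "continuous_on UNIV (\<lambda>z. p z * gauss z)"
      by (intro continuous_intros continuous_gauss assms)
    fix z :: 'a
    have "\<bar>p z\<bar> \<le> K * exp ((z \<bullet> z) / 4)"
      using p[of z] exp_ge_add_one_self[of "(z \<bullet> z) / 4"] K
      by (meson mult_left_mono order_trans)
    then have "\<bar>p z * gauss z\<bar> \<le> K * exp ((z \<bullet> z) / 4) * gauss z"
      using gauss_pos[of z] by (simp add: abs_mult)
    also have "\<dots> = K / ?N * (exp ((z \<bullet> z) / 4) * exp (- (z \<bullet> z) / 2))"
      by (simp add: gauss_def)
    also have "exp ((z \<bullet> z) / 4) * exp (- (z \<bullet> z) / 2) = exp (- (z \<bullet> z) / 4)"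
      by (simp add: exp_add[symmetric])
    finally show "\<bar>p z * gauss z\<bar> \<le> K / ?N * exp (- (z \<bullet> z) / 4)" .
  qed
  then show ?thesis ..
qed

text \<open>Minus the derivative of \<open>gauss\<close> along \<open>e\<close>; the sign is the one
  produced by translating the argument by \<open>- s *\<^sub>R e\<close>.\<close>

definition gauss1 :: "'a::euclidean_space \<Rightarrow> 'a \<Rightarrow> real" where
  "gauss1 e z = (z \<bullet> e) * gauss z"

text \<open>The second derivative of \<open>gauss\<close> along \<open>e\<close> and
  \<open>f\<close>, that is, a Hermite polynomial of degree two times \<open>gauss\<close>.\<close>

definition gauss2 :: "'a::euclidean_space \<Rightarrow> 'a \<Rightarrow> 'a \<Rightarrow> real" where
  "gauss2 e f z = ((z \<bullet> e) * (z \<bullet> f) - e \<bullet> f) * gauss z"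

lemma gaussian_decay_gauss: "\<exists>C. gaussian_decay C (gauss :: 'a::euclidean_space \<Rightarrow> real)"
  using gaussian_decay_poly[of "\<lambda>_::'a. 1" 1] by simp

lemma gaussian_decay_gauss1: "\<exists>C. gaussian_decay C (gauss1 e)"
  unfolding gauss1_def
proof (rule gaussian_decay_poly)
  fix z
  have "\<bar>z \<bullet> e\<bar> \<le> norm z * norm e" by (rule Cauchy_Schwarz_ineq2)
  also have "norm z \<le> 1 + (z \<bullet> z) / 4"
    using zero_le_power2[of "1 - norm z / 2"] by (simp add: power2_norm_eq_inner[symmetric] power2_eq_square field_simps)
  finally show "\<bar>z \<bullet> e\<bar> \<le> norm e * (1 + (z \<bullet> z) / 4)"
    by (simp add: mult.commute mult_right_mono)
qed (intro continuous_intros)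

lemma gaussian_decay_gauss2: "\<exists>C. gaussian_decay C (gauss2 e f)"
  unfolding gauss2_def
proof (rule gaussian_decay_poly)
  fix z
  have "\<bar>z \<bullet> e\<bar> * \<bar>z \<bullet> f\<bar> \<le> (norm z * norm e) * (norm z * norm f)"
    by (intro mult_mono Cauchy_Schwarz_ineq2) auto
  moreover have "\<bar>e \<bullet> f\<bar> \<le> norm e * norm f" by (rule Cauchy_Schwarz_ineq2)
  ultimately have "\<bar>(z \<bullet> e) * (z \<bullet> f) - e \<bullet> f\<bar> \<le> norm e * norm f * (1 + z \<bullet> z)"
    by (simp add: power2_norm_eq_inner[symmetric] power2_eq_square algebra_simps abs_mult[symmetric])
  also have "\<dots> \<le> norm e * norm f * (4 * (1 + (z \<bullet> z) / 4))"
    by (intro mult_left_mono) (auto simp: )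
  finally show "\<bar>(z \<bullet> e) * (z \<bullet> f) - e \<bullet> f\<bar> \<le> (4 * (norm e * norm f)) * (1 + (z \<bullet> z) / 4)"
    by (simp add: algebra_simps)
qed (intro continuous_intros)

lemma gauss_has_derivative:
  "((\<lambda>s. gauss (z - s *\<^sub>R e)) has_real_derivative gauss1 e (z - s *\<^sub>R e)) (at s)"
  unfolding gauss_def gauss1_def using gauss_mass_pos[where 'a = 'a]
  by (auto intro!: derivative_eq_intros simp: inner_diff_left inner_diff_right inner_commute field_simps power2_eq_square)

lemma gauss1_has_derivative:
  "((\<lambda>s. gauss1 e (z - s *\<^sub>R f)) has_real_derivative gauss2 e f (z - s *\<^sub>R f)) (at s)"
  unfolding gauss1_def gauss2_def
  by (rule derivative_eq_intros gauss_has_derivative refl | simp add: inner_diff_left)+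
    (simp add: gauss1_def inner_diff_left inner_commute algebra_simps)

text \<open>For \<open>\<phi> = gauss\<close> this is the heat semigroup at time
  \<open>r\<^sup>2 / 2\<close> applied to \<open>g\<close>; the other kernels give its rescaled
  derivatives. With the scaling inside \<open>g\<close>, the value \<open>r = 0\<close> is regular
  and gives \<open>g x\<close> times the mass of the kernel.\<close>

definition avg :: "('a::euclidean_space \<Rightarrow> real) \<Rightarrow> ('a \<Rightarrow> real) \<Rightarrow> real \<Rightarrow> 'a \<Rightarrow> real" where
  "avg \<phi> g r x = (\<integral>z. \<phi> z * g (x + r *\<^sub>R z) \<partial>lborel)"

lemma avg_integrable:
  assumes \<phi>: "gaussian_decay C \<phi>" and g: "continuous_on UNIV g" "\<And>y. \<bar>g y\<bar> \<le> M"
  shows "integrable lborel (\<lambda>z. \<phi> z * g (x + r *\<^sub>R z))"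
proof (rule Bochner_Integration.integrable_bound)
  show "integrable lborel (\<lambda>z. M * \<phi> z)"
    using gaussian_decay_integrable[OF \<phi>] by (rule integrable_mult_right)
  have [measurable]: "\<phi> \<in> borel_measurable borel" "g \<in> borel_measurable borel"
    using \<phi> g by (auto simp: gaussian_decay_measurable borel_measurable_continuous_onI)
  show "(\<lambda>z. \<phi> z * g (x + r *\<^sub>R z)) \<in> borel_measurable lborel" by measurable
  show "AE z in lborel. norm (\<phi> z * g (x + r *\<^sub>R z)) \<le> norm (M * \<phi> z)"
    using g(2) by (auto simp: abs_mult mult.commute[of "\<bar>M\<bar>"] intro!: AE_I2 mult_left_mono intro: order_trans[OF _ abs_ge_self])
qed

lemma avg_bound:
  assumes \<phi>: "gaussian_decay C \<phi>" and g: "continuous_on UNIV g" "\<And>y. \<bar>g y\<bar> \<le> M"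
  shows "\<bar>avg \<phi> g r x\<bar> \<le> M * (\<integral>z. \<bar>\<phi> z\<bar> \<partial>lborel)"
proof -
  have "\<bar>avg \<phi> g r x\<bar> \<le> (\<integral>z. \<bar>\<phi> z * g (x + r *\<^sub>R z)\<bar> \<partial>lborel)"
    unfolding avg_def by (rule integral_abs_bound)
  also have "\<dots> \<le> (\<integral>z. M * \<bar>\<phi> z\<bar> \<partial>lborel)"
    using avg_integrable[OF \<phi> g] gaussian_decay_integrable[OF \<phi>] g(2)
    by (intro integral_mono integrable_abs integrable_mult_right)
      (auto simp: abs_mult mult.commute[of M] intro!: mult_left_mono)
  finally show ?thesis by simp
qed

lemma avg_tendsto:
  assumes \<phi>: "gaussian_decay C \<phi>" and g: "continuous_on UNIV g" "\<And>y. \<bar>g y\<bar> \<le> M"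
    and r: "r \<longlonglongrightarrow> r0" and x: "x \<longlonglongrightarrow> x0"
  shows "(\<lambda>i. avg \<phi> g (r i) (x i)) \<longlonglongrightarrow> avg \<phi> g r0 x0"
  unfolding avg_def
proof (rule integral_dominated_convergence[where w = "\<lambda>z. M * \<bar>\<phi> z\<bar>"])
  show "integrable lborel (\<lambda>z. M * \<bar>\<phi> z\<bar>)"
    using gaussian_decay_integrable[OF \<phi>] by auto
  show "(\<lambda>z. \<phi> z * g (x0 + r0 *\<^sub>R z)) \<in> borel_measurable lborel"
    "\<And>i. (\<lambda>z. \<phi> z * g (x i + r i *\<^sub>R z)) \<in> borel_measurable lborel"
    using avg_integrable[OF \<phi> g] by (blast dest: borel_measurable_integrable)+
  show "AE z in lborel. norm (\<phi> z * g (x i + r i *\<^sub>R z)) \<le> M * \<bar>\<phi> z\<bar>" for i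
    using g(2) by (auto simp: abs_mult mult.commute[of M] intro!: mult_left_mono)
  have "(\<lambda>i. g (x i + r i *\<^sub>R z)) \<longlonglongrightarrow> g (x0 + r0 *\<^sub>R z)" for z
    by (rule continuous_on_tendsto_compose[OF g(1)]) (auto intro!: tendsto_intros r x)
  then show "AE z in lborel. (\<lambda>i. \<phi> z * g (x i + r i *\<^sub>R z)) \<longlonglongrightarrow> \<phi> z * g (x0 + r0 *\<^sub>R z)"
    by (auto intro!: tendsto_intros)
qed

text \<open>As \<open>g\<close> is only continuous, the translation has to be moved onto the kernel
  before differentiating. Moving the point by \<open>r * s\<close> along \<open>e\<close> translates
  the kernel by \<open>s\<close>, whence the division by \<open>r\<close>.\<close>

lemma avg_has_derivative:
  assumes \<phi>: "gaussian_decay C \<phi>" and \<psi>: "gaussian_decay C' \<psi>"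
    and deriv: "\<And>z s. ((\<lambda>s. \<phi> (z - s *\<^sub>R e)) has_real_derivative \<psi> (z - s *\<^sub>R e)) (at s)"
    and g: "continuous_on UNIV g" "\<And>y. \<bar>g y\<bar> \<le> M" and r: "r \<noteq> 0"
  shows "((\<lambda>s. avg \<phi> g r (x + s *\<^sub>R e)) has_real_derivative avg \<psi> g r (x + s0 *\<^sub>R e) / r) (at s0)"
proof -
  have meas[measurable]: "\<phi> \<in> borel_measurable borel" "\<psi> \<in> borel_measurable borel" "g \<in> borel_measurable borel"
    using \<phi> \<psi> g by (auto simp: gaussian_decay_measurable borel_measurable_continuous_onI)
  have M: "M \<ge> 0" using g(2)[of 0] by linarith
  define x' where "x' = x + s0 *\<^sub>R e"
  have shift: "avg \<phi> g r (x' + (r * s) *\<^sub>R e) = (\<integral>z. \<phi> (z - s *\<^sub>R e) * g (x' + r *\<^sub>R z) \<partial>lborel)" for s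
    unfolding avg_def
    by (subst lborel_integral_affine[of 1 _ "s *\<^sub>R e"]) (auto simp: algebra_simps)
  have "((\<lambda>s. \<integral>z. \<phi> (z - s *\<^sub>R e) * g (x' + r *\<^sub>R z) \<partial>lborel) has_real_derivative
      (\<integral>z. \<psi> (z - 0 *\<^sub>R e) * g (x' + r *\<^sub>R z) \<partial>lborel)) (at 0)"
  proof (rule has_real_derivative_integral_dominated[where d = 1
        and B = "\<lambda>z. M * C' * exp (e \<bullet> e / 4) * exp (- (z \<bullet> z) / 8)"])
    show "((\<lambda>s. \<phi> (z - s *\<^sub>R e) * g (x' + r *\<^sub>R z)) has_real_derivative
        \<psi> (z - s *\<^sub>R e) * g (x' + r *\<^sub>R z)) (at s)" for s z
      by (intro DERIV_cmult_right deriv)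
    show "integrable lborel (\<lambda>z. M * C' * exp (e \<bullet> e / 4) * exp (- (z \<bullet> z) / 8))"
      by (intro integrable_mult_right integrable_gaussian') simp
    show "(\<lambda>z. \<psi> (z - 0 *\<^sub>R e) * g (x' + r *\<^sub>R z)) \<in> borel_measurable lborel" by measurable
    fix s :: real assume s: "\<bar>s - 0\<bar> < 1"
    show "\<bar>\<psi> (z - s *\<^sub>R e) * g (x' + r *\<^sub>R z)\<bar> \<le> M * C' * exp (e \<bullet> e / 4) * exp (- (z \<bullet> z) / 8)" for z
    proof -
      let ?y = "z - s *\<^sub>R e"
      \<comment> \<open>The parallelogram bound |z|^2 \<le> 2|y|^2 + 2 s^2 |e|^2 makes the
        domination uniform in |s| < 1, at the price of the rate dropping from 1/4 to 1/8.\<close>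
      have "0 \<le> (?y - s *\<^sub>R e) \<bullet> (?y - s *\<^sub>R e)" by (rule inner_ge_zero)
      then have "z \<bullet> z \<le> 2 * (?y \<bullet> ?y) + 2 * (s\<^sup>2 * (e \<bullet> e))"
        by (simp add: inner_diff_left inner_diff_right inner_commute power2_eq_square algebra_simps)
      moreover have "s\<^sup>2 * (e \<bullet> e) \<le> e \<bullet> e"
        using s by (intro mult_left_le_one_le) (auto simp: abs_square_le_1)
      ultimately have "- (?y \<bullet> ?y) / 4 \<le> e \<bullet> e / 4 + - (z \<bullet> z) / 8" by simp
      then have "exp (- (?y \<bullet> ?y) / 4) \<le> exp (e \<bullet> e / 4) * exp (- (z \<bullet> z) / 8)"
        by (simp add: exp_add[symmetric])
      then have "C' * exp (- (?y \<bullet> ?y) / 4) \<le> C' * (exp (e \<bullet> e / 4) * exp (- (z \<bullet> z) / 8))"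
        using gaussian_decay_nonneg[OF \<psi>] by (intro mult_left_mono)
      then have "\<bar>\<psi> ?y\<bar> \<le> C' * (exp (e \<bullet> e / 4) * exp (- (z \<bullet> z) / 8))"
        using \<psi> unfolding gaussian_decay_def by (meson order_trans)
      then have "\<bar>\<psi> ?y\<bar> * \<bar>g (x' + r *\<^sub>R z)\<bar> \<le> C' * (exp (e \<bullet> e / 4) * exp (- (z \<bullet> z) / 8)) * M"
        using M gaussian_decay_nonneg[OF \<psi>] by (intro mult_mono g(2)) auto
      then show ?thesis by (simp add: abs_mult mult_ac)
    qed
    show "integrable lborel (\<lambda>z. \<phi> (z - s *\<^sub>R e) * g (x' + r *\<^sub>R z))"
    proof (rule integrableI_bounded)
      show "(\<integral>\<^sup>+ z. ennreal (norm (\<phi> (z - s *\<^sub>R e) * g (x' + r *\<^sub>R z))) \<partial>lborel) < \<infinity>"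
      proof (subst lborel_affine[of 1 "s *\<^sub>R e"])
        show "(\<integral>\<^sup>+ z. ennreal (norm (\<phi> (z - s *\<^sub>R e) * g (x' + r *\<^sub>R z)))
          \<partial>density (distr lborel borel (\<lambda>x. s *\<^sub>R e + 1 *\<^sub>R x)) (\<lambda>_. ennreal (\<bar>1\<bar> ^ DIM('a)))) < \<infinity>"
          using integrableD(2)[OF integrable_abs[OF avg_integrable[OF \<phi> g, of "x' + (r * s) *\<^sub>R e" r]]]
          by (simp add: nn_integral_density nn_integral_distr less_top algebra_simps)
      qed simp
    qed measurable
  qed simp_all
  then have "((\<lambda>s. avg \<phi> g r (x' + (r * s) *\<^sub>R e)) has_real_derivative avg \<psi> g r x') (at 0)"
    using avg_def[of \<psi> g r x'] by (simp add: shift)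
  then have "((\<lambda>s. avg \<phi> g r (x' + (r * s) *\<^sub>R e)) has_real_derivative avg \<psi> g r x') (at ((s0 - s0) / r))"
    by simp
  moreover have "((\<lambda>s. (s - s0) / r) has_real_derivative 1 / r) (at s0)"
    using r by (auto intro!: derivative_eq_intros)
  ultimately have D: "((\<lambda>s. avg \<phi> g r (x' + (r * ((s - s0) / r)) *\<^sub>R e)) has_real_derivative avg \<psi> g r x' * (1 / r)) (at s0)"
    by (rule DERIV_chain2)
  have eq: "x' + (r * ((s - s0) / r)) *\<^sub>R e = x + s *\<^sub>R e" for s
    using r by (simp add: x'_def scaleR_diff_left)
  show ?thesis using D unfolding eq by (simp add: x'_def)
qed

text \<open>The heat equation in the scale variable: the kernel on the right is the Laplacian of
  \<open>gauss\<close>. The substitution \<open>y = r z\<close> first moves the scale from the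
  non-differentiable \<open>g\<close> onto the Gaussian.\<close>

lemma avg_gauss_has_derivative_scale:
  fixes g :: "'a::euclidean_space \<Rightarrow> real"
  assumes g: "continuous_on UNIV g" "\<And>y. \<bar>g y\<bar> \<le> M" and r: "r > 0"
  shows "((\<lambda>\<rho>. avg gauss g \<rho> x) has_real_derivative
    avg (\<lambda>z. (z \<bullet> z - DIM('a)) * gauss z) g r x / r) (at r)"
proof -
  let ?n = "DIM('a)"
  let ?N = "\<integral>y. exp (- ((y::'a) \<bullet> y) / 2) \<partial>lborel"
  have meas[measurable]: "(gauss :: 'a \<Rightarrow> real) \<in> borel_measurable borel" "g \<in> borel_measurable borel"
    using g by (auto intro!: borel_measurable_continuous_onI continuous_gauss)
  have M: "M \<ge> 0" using g(2)[of 0] by linarith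
  have affine: "(\<integral>z. f z * g (x + \<rho> *\<^sub>R z) \<partial>lborel) = (1 / \<rho>) ^ ?n * (\<integral>y. f ((1 / \<rho>) *\<^sub>R y) * g (x + y) \<partial>lborel)"
    if [measurable]: "f \<in> borel_measurable borel" and "\<rho> > 0" for f \<rho>
    using that(2) by (subst lborel_integral_affine[of \<rho> _ 0]) (auto simp: power_one_over)
  let ?H = "\<lambda>\<rho> y. (1 / \<rho>) ^ ?n * gauss ((1 / \<rho>) *\<^sub>R y) * g (x + y)"
  let ?H' = "\<lambda>\<rho> y. (1 / \<rho>) ^ Suc ?n * ((((1 / \<rho>) *\<^sub>R y) \<bullet> ((1 / \<rho>) *\<^sub>R y) - ?n) * gauss ((1 / \<rho>) *\<^sub>R y)) * g (x + y)"
  obtain C where C: "gaussian_decay C (\<lambda>z::'a. (z \<bullet> z - ?n) * gauss z)"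
  proof -
    have "\<exists>C. gaussian_decay C (\<lambda>z::'a. (z \<bullet> z - ?n) * gauss z)"
    proof (rule gaussian_decay_poly[where K = "4 + ?n"])
      fix z :: 'a
      have "\<bar>z \<bullet> z - ?n\<bar> \<le> z \<bullet> z + ?n" using inner_ge_zero[of z] by linarith
      also have "\<dots> \<le> (4 + ?n) * (1 + (z \<bullet> z) / 4)"
        using mult_nonneg_nonneg[OF inner_ge_zero[of z], of "real ?n"] by (simp add: field_simps)
      finally show "\<bar>z \<bullet> z - ?n\<bar> \<le> (4 + ?n) * (1 + (z \<bullet> z) / 4)" .
    qed (intro continuous_intros)
    then show ?thesis using that by blast
  qed
  have C0: "C \<ge> 0" by (rule gaussian_decay_nonneg[OF C])
  obtain C1 where C1: "gaussian_decay C1 (gauss :: 'a \<Rightarrow> real)" using gaussian_decay_gauss by blast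
  have "((\<lambda>\<rho>. \<integral>y. ?H \<rho> y \<partial>lborel) has_real_derivative (\<integral>y. ?H' r y \<partial>lborel)) (at r)"
  \<comment> \<open>For \<rho> within \<open>r / 2\<close> of \<open>r\<close> one has
    \<open>1 / \<rho> \<le> 2 / r\<close> and \<open>4 * \<rho>\<^sup>2 \<le> 9 * r\<^sup>2\<close>,
    which gives both constants of the dominating function.\<close>
  proof (rule has_real_derivative_integral_dominated[where d = "r / 2"
        and B = "\<lambda>y. M * ((2 / r) ^ Suc ?n * C) * exp (- (y \<bullet> y) / (9 * r\<^sup>2))"])
    show "r / 2 > 0" using r by simp
    show "integrable lborel (\<lambda>y::'a. M * ((2 / r) ^ Suc ?n * C) * exp (- (y \<bullet> y) / (9 * r\<^sup>2)))"
      using r by (intro integrable_mult_right integrable_gaussian') simp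
    show "?H' r \<in> borel_measurable lborel" by measurable
    fix \<rho> assume "\<bar>\<rho> - r\<bar> < r / 2"
    then have \<rho>: "r / 2 < \<rho>" "\<rho> < 3 * r / 2" "\<rho> > 0" using r unfolding abs_less_iff by linarith+
    show "((\<lambda>\<rho>. ?H \<rho> y) has_real_derivative ?H' \<rho> y) (at \<rho>)" for y
    proof -
      have "((\<lambda>\<rho>. gauss ((1 / \<rho>) *\<^sub>R y)) has_real_derivative
          ((y \<bullet> y) / \<rho> ^ 3) * gauss ((1 / \<rho>) *\<^sub>R y)) (at \<rho>)"
        unfolding gauss_def using gauss_mass_pos[where 'a = 'a] \<rho>(3)
        by (auto intro!: derivative_eq_intros simp: field_simps power2_eq_square power3_eq_cube)
      moreover have "((\<lambda>\<rho>. (1 / \<rho>) ^ ?n) has_real_derivative - ?n * (1 / \<rho>) ^ Suc ?n) (at \<rho>)"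
      proof -
        have "?n = Suc (?n - 1)" by simp
        then obtain m where m: "?n = Suc m" by blast
        have "((\<lambda>\<rho>. 1 / \<rho>) has_real_derivative - (1 / \<rho>\<^sup>2)) (at \<rho>)"
          using \<rho>(3) by (auto intro!: derivative_eq_intros simp: power2_eq_square)
        from DERIV_power[OF this, of "Suc m"] show ?thesis unfolding m
          by (rule DERIV_cong) (simp add: power2_eq_square del: of_nat_Suc)
      qed
      ultimately have "((\<lambda>\<rho>. (1 / \<rho>) ^ ?n * gauss ((1 / \<rho>) *\<^sub>R y)) has_real_derivative
          (- ?n * (1 / \<rho>) ^ Suc ?n) * gauss ((1 / \<rho>) *\<^sub>R y)
          + (((y \<bullet> y) / \<rho> ^ 3) * gauss ((1 / \<rho>) *\<^sub>R y)) * (1 / \<rho>) ^ ?n) (at \<rho>)"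
        by (intro DERIV_mult)
      from DERIV_cmult_right[OF this, of "g (x + y)"] show ?thesis
        by (rule DERIV_cong) (use \<rho>(3) in \<open>simp add: field_simps power3_eq_cube power2_eq_square\<close>)
    qed
    show "\<bar>?H' \<rho> y\<bar> \<le> M * ((2 / r) ^ Suc ?n * C) * exp (- (y \<bullet> y) / (9 * r\<^sup>2))" for y
    proof -
      let ?z = "(1 / \<rho>) *\<^sub>R y"
      have "\<bar>(?z \<bullet> ?z - ?n) * gauss ?z\<bar> \<le> C * exp (- (?z \<bullet> ?z) / 4)"
        using C unfolding gaussian_decay_def by blast
      also have "\<dots> \<le> C * exp (- (y \<bullet> y) / (9 * r\<^sup>2))"
      proof -
        have "(2 * \<rho>)\<^sup>2 \<le> (3 * r)\<^sup>2" using \<rho> by (intro power_mono) auto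
        then have "4 * \<rho>\<^sup>2 \<le> 9 * r\<^sup>2" by (simp add: power_mult_distrib)
        then have "(y \<bullet> y) / (9 * r\<^sup>2) \<le> (y \<bullet> y) / (4 * \<rho>\<^sup>2)"
          using \<rho> by (intro divide_left_mono) auto
        also have "\<dots> = (?z \<bullet> ?z) / 4" by (simp add: power2_eq_square)
        finally show ?thesis using C0 by (intro mult_left_mono) auto
      qed
      finally have 1: "\<bar>(?z \<bullet> ?z - ?n) * gauss ?z\<bar> \<le> C * exp (- (y \<bullet> y) / (9 * r\<^sup>2))" .
      have 2: "\<bar>(1 / \<rho>) ^ Suc ?n\<bar> \<le> (2 / r) ^ Suc ?n"
        unfolding power_abs using \<rho> r by (intro power_mono) (auto simp: field_simps)
      have "\<bar>?H' \<rho> y\<bar> = \<bar>(1 / \<rho>) ^ Suc ?n\<bar> * \<bar>(?z \<bullet> ?z - ?n) * gauss ?z\<bar> * \<bar>g (x + y)\<bar>"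
        by (simp add: abs_mult)
      also have "\<dots> \<le> (2 / r) ^ Suc ?n * (C * exp (- (y \<bullet> y) / (9 * r\<^sup>2))) * M"
        using r M C0 by (intro mult_mono 1 2 g(2)) auto
      finally show ?thesis by (simp add: mult_ac)
    qed
    show "integrable lborel (?H \<rho>)"
    proof (rule Bochner_Integration.integrable_bound[where f = "\<lambda>y. M * ((1 / \<rho>) ^ ?n * C1) * exp (- (y \<bullet> y) / (4 * \<rho>\<^sup>2))"])
      show "integrable lborel (\<lambda>y::'a. M * ((1 / \<rho>) ^ ?n * C1) * exp (- (y \<bullet> y) / (4 * \<rho>\<^sup>2)))"
        using \<rho> by (intro integrable_mult_right integrable_gaussian') simp
      show "?H \<rho> \<in> borel_measurable lborel" by measurable
      have "norm (?H \<rho> y) \<le> M * ((1 / \<rho>) ^ ?n * C1) * exp (- (y \<bullet> y) / (4 * \<rho>\<^sup>2))" for y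
      proof -
        have "\<bar>gauss ((1 / \<rho>) *\<^sub>R y)\<bar> \<le> C1 * exp (- (y \<bullet> y) / (4 * \<rho>\<^sup>2))"
          using C1 unfolding gaussian_decay_def
          by (auto dest!: spec[of _ "(1 / \<rho>) *\<^sub>R y"] simp: power2_eq_square mult_ac)
        then have "(1 / \<rho>) ^ ?n * \<bar>gauss ((1 / \<rho>) *\<^sub>R y)\<bar> * \<bar>g (x + y)\<bar>
          \<le> (1 / \<rho>) ^ ?n * (C1 * exp (- (y \<bullet> y) / (4 * \<rho>\<^sup>2))) * M"
          using \<rho> M gaussian_decay_nonneg[OF C1] by (intro mult_mono g(2)) auto
        then show ?thesis using \<rho> by (simp add: abs_mult mult_ac power_abs[symmetric])
      qed
      then show "AE y in lborel. norm (?H \<rho> y) \<le> norm (M * ((1 / \<rho>) ^ ?n * C1) * exp (- (y \<bullet> y) / (4 * \<rho>\<^sup>2)))"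
        by (auto intro!: AE_I2 order_trans[OF _ abs_ge_self])
    qed
  qed
  moreover have "(\<integral>y. ?H' r y \<partial>lborel) = avg (\<lambda>z. (z \<bullet> z - ?n) * gauss z) g r x / r"
    unfolding avg_def using r by (subst affine) (auto simp: mult.assoc)
  moreover have "\<forall>\<^sub>F \<rho> in nhds r. avg gauss g \<rho> x = (\<integral>y. ?H \<rho> y \<partial>lborel)"
    using eventually_nhds_in_open[of "{0<..}" r] r
    by (auto elim!: eventually_mono simp: avg_def affine mult.assoc)
  ultimately show ?thesis
    using r by (subst DERIV_cong_ev[OF refl _ refl]) auto
qed

section \<open>The resolvent of the Laplacian\<close>

text \<open>A restricted measure rather than an indicator in the integrand: positivity of
  \<open>r\<close> then comes as membership in the space, which is the form used by the dominated
  differentiation lemma.\<close>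

definition halfline :: "real measure" where
  "halfline = restrict_space lborel {0<..}"

lemma space_halfline [simp]: "space halfline = {0<..}"
  by (simp add: halfline_def space_restrict_space)

lemma borel_measurable_halfline:
  "f \<in> borel_measurable borel \<Longrightarrow> f \<in> borel_measurable halfline"
  unfolding halfline_def by (rule measurable_restrict_space1) simp

lemma integrable_halfline:
  fixes f :: "real \<Rightarrow> real"
  assumes "integrable lborel f"
  shows "integrable halfline f"
  unfolding halfline_def
  by (subst integrable_restrict_space) (use integrable_mult_indicator[of "{0<..}" lborel f] assms in auto)

lemma integral_halfline:
  fixes f :: "real \<Rightarrow> real"
  shows "integral\<^sup>L halfline f = set_lebesgue_integral lborel {0<..} f"
  by (simp add: halfline_def set_lebesgue_integral_def integral_restrict_space)

lemma integrable_halfline_gauss: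
  assumes "k > 0"
  shows "integrable halfline (\<lambda>r. exp (- (k * r\<^sup>2) / 2))"
  using integrable_gaussian[of "k / 2", where 'a = real] assms
  by (intro integrable_halfline) (simp add: power2_eq_square)

lemma integrable_halfline_gauss_moment:
  assumes "k > 0"
  shows "integrable halfline (\<lambda>r. r * exp (- (k * r\<^sup>2) / 2))"
proof (rule Bochner_Integration.integrable_bound)
  \<comment> \<open>Half of the exponent is spent on the factor \<open>r\<close>: |r| \<le> 1 + r^2,
    and \<open>?c\<close> is large enough for this to be at most
    \<open>?c * (1 + k * r\<^sup>2 / 4)\<close>.\<close>
  let ?c = "max 1 (4 / k)"
  show "integrable halfline (\<lambda>r. ?c * exp (- ((k / 2) * r\<^sup>2) / 2))"
    using assms by (intro integrable_mult_right integrable_halfline_gauss) simp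
  show "(\<lambda>r. r * exp (- (k * r\<^sup>2) / 2)) \<in> borel_measurable halfline"
    by (rule borel_measurable_halfline) measurable
  have "norm (r * exp (- (k * r\<^sup>2) / 2)) \<le> ?c * exp (- ((k / 2) * r\<^sup>2) / 2)" for r
  proof -
    have "r\<^sup>2 = (4 / k) * (k * r\<^sup>2 / 4)" using assms by simp
    also have "\<dots> \<le> ?c * (k * r\<^sup>2 / 4)" using assms by (intro mult_right_mono) auto
    finally have r2: "r\<^sup>2 \<le> ?c * (k * r\<^sup>2 / 4)" .
    have "\<bar>r\<bar> \<le> 1 + r\<^sup>2"
      using zero_le_power2[of "\<bar>r\<bar> - 1"] by (simp add: power2_eq_square algebra_simps)
    also have "\<dots> \<le> ?c * (1 + k * r\<^sup>2 / 4)" using r2 by (simp add: distrib_left add_mono)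
    also have "\<dots> \<le> ?c * exp (k * r\<^sup>2 / 4)"
      by (intro mult_left_mono exp_ge_add_one_self) auto
    finally have "\<bar>r\<bar> * exp (- (k * r\<^sup>2) / 2) \<le> ?c * exp (k * r\<^sup>2 / 4) * exp (- (k * r\<^sup>2) / 2)"
      by (intro mult_right_mono) auto
    also have "\<dots> = ?c * (exp (k * r\<^sup>2 / 4) * exp (- (k * r\<^sup>2) / 2))" by (rule mult.assoc)
    also have "exp (k * r\<^sup>2 / 4) * exp (- (k * r\<^sup>2) / 2) = exp (- ((k / 2) * r\<^sup>2) / 2)"
      by (simp add: exp_add[symmetric])
    finally show ?thesis by (simp add: abs_mult)
  qed
  then show "AE r in halfline. norm (r * exp (- (k * r\<^sup>2) / 2)) \<le> norm (?c * exp (- ((k / 2) * r\<^sup>2) / 2))"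
    by (auto intro!: AE_I2 intro: order_trans[OF _ abs_ge_self])
qed

lemma avg_continuous:
  assumes \<phi>: "gaussian_decay C \<phi>" and g: "continuous_on UNIV g" "\<And>y. \<bar>g y\<bar> \<le> M"
  shows "continuous_on UNIV (\<lambda>r. avg \<phi> g r x)"
  unfolding continuous_on_sequentially comp_def
  using avg_tendsto[OF \<phi> g _ tendsto_const] by blast

lemma avg_measurable:
  assumes \<phi>: "gaussian_decay C \<phi>" and g: "continuous_on UNIV g" "\<And>y. \<bar>g y\<bar> \<le> M"
  shows "(\<lambda>r. avg \<phi> g r x) \<in> borel_measurable borel"
  by (rule borel_measurable_continuous_onI) (rule avg_continuous[OF \<phi> g])

lemma integrable_halfline_bounded_mult:
  assumes w: "integrable halfline w" and f: "f \<in> borel_measurable halfline" "\<And>r. r > 0 \<Longrightarrow> \<bar>f r\<bar> \<le> (K::real)"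
  shows "integrable halfline (\<lambda>r. w r * f r)"
proof (rule Bochner_Integration.integrable_bound)
  show "integrable halfline (\<lambda>r. K * w r)" using w by (rule integrable_mult_right)
  show "(\<lambda>r. w r * f r) \<in> borel_measurable halfline"
    using w f(1) by (intro borel_measurable_times) (auto dest: borel_measurable_integrable)
  show "AE r in halfline. norm (w r * f r) \<le> norm (K * w r)"
    using f(2) by (auto simp: abs_mult mult.commute[of "\<bar>K\<bar>"] intro!: AE_I2 mult_left_mono intro: order_trans[OF _ abs_ge_self])
qed

text \<open>Laplace transform \<open>\<integral> e\<^sup>-\<^sup>k\<^sup>t e\<^sup>t\<^sup>\<Delta> g dt\<close> of the heat semigroup in the variable \<open>t = r\<^sup>2/2\<close>, which removes
  the singularities of the differentiated integrands at \<open>r = 0\<close>.\<close>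

definition resolvent :: "real \<Rightarrow> ('a::euclidean_space \<Rightarrow> real) \<Rightarrow> 'a \<Rightarrow> real" where
  "resolvent k g x = (\<integral>r. (r * exp (- (k * r\<^sup>2) / 2)) * avg gauss g r x \<partial>halfline)"

definition resolvent1 :: "real \<Rightarrow> 'a \<Rightarrow> ('a::euclidean_space \<Rightarrow> real) \<Rightarrow> 'a \<Rightarrow> real" where
  "resolvent1 k e g x = (\<integral>r. exp (- (k * r\<^sup>2) / 2) * avg (gauss1 e) g r x \<partial>halfline)"

definition resolvent2 :: "real \<Rightarrow> 'a \<Rightarrow> 'a \<Rightarrow> ('a::euclidean_space \<Rightarrow> real) \<Rightarrow> 'a \<Rightarrow> real" where
  "resolvent2 k e f g x = (\<integral>r. exp (- (k * r\<^sup>2) / 2) * (avg (gauss2 e f) g r x / r) \<partial>halfline)"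

context
  fixes g :: "'a::euclidean_space \<Rightarrow> real" and M :: real
  assumes g: "continuous_on UNIV g" "\<And>y. \<bar>g y\<bar> \<le> M"
begin

lemma integrable_resolvent:
  assumes "k > 0"
  shows "integrable halfline (\<lambda>r. (r * exp (- (k * r\<^sup>2) / 2)) * avg gauss g r x)"
proof -
  obtain C where C: "gaussian_decay C (gauss :: 'a \<Rightarrow> real)" using gaussian_decay_gauss by blast
  show ?thesis
    by (rule integrable_halfline_bounded_mult[OF integrable_halfline_gauss_moment[OF assms]])
      (auto intro: borel_measurable_halfline avg_measurable[OF C g] avg_bound[OF C g])
qed

lemma integrable_resolvent1:
  assumes "k > 0"
  shows "integrable halfline (\<lambda>r. exp (- (k * r\<^sup>2) / 2) * avg (gauss1 e) g r x)"
proof -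
  obtain C where C: "gaussian_decay C (gauss1 e)" using gaussian_decay_gauss1 by blast
  show ?thesis
    by (rule integrable_halfline_bounded_mult[OF integrable_halfline_gauss[OF assms]])
      (auto intro: borel_measurable_halfline avg_measurable[OF C g] avg_bound[OF C g])
qed

text \<open>The weight \<open>r\<close> coming from the substitution
  \<open>t = r\<^sup>2 / 2\<close> cancels the division by \<open>r\<close> in
  \<open>avg_has_derivative\<close>, so bounded continuous data suffice for one derivative.\<close>

lemma resolvent_has_derivative:
  assumes k: "k > 0"
  shows "((\<lambda>s. resolvent k g (x + s *\<^sub>R e)) has_real_derivative resolvent1 k e g (x + s0 *\<^sub>R e)) (at s0)"
  unfolding resolvent_def resolvent1_def
proof (rule has_real_derivative_integral_dominated[where d = 1 and
      B = "\<lambda>r. exp (- (k * r\<^sup>2) / 2) * (M * (\<integral>z. \<bar>gauss1 e z\<bar> \<partial>lborel))"])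
  obtain C where C: "gaussian_decay C (gauss :: 'a \<Rightarrow> real)" using gaussian_decay_gauss by blast
  obtain C1 where C1: "gaussian_decay C1 (gauss1 e)" using gaussian_decay_gauss1 by blast
  show "integrable halfline (\<lambda>r. exp (- (k * r\<^sup>2) / 2) * (M * (\<integral>z. \<bar>gauss1 e z\<bar> \<partial>lborel)))"
    by (intro integrable_mult_left integrable_halfline_gauss k)
  show "(\<lambda>r. exp (- (k * r\<^sup>2) / 2) * avg (gauss1 e) g r (x + s0 *\<^sub>R e)) \<in> borel_measurable halfline"
    using integrable_resolvent1[OF k] by (rule borel_measurable_integrable)
  fix s :: real
  show "integrable halfline (\<lambda>r. (r * exp (- (k * r\<^sup>2) / 2)) * avg gauss g r (x + s *\<^sub>R e))"
    by (rule integrable_resolvent[OF k])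
  fix r assume "r \<in> space halfline"
  then have r: "r > 0" by simp
  show "((\<lambda>s. (r * exp (- (k * r\<^sup>2) / 2)) * avg gauss g r (x + s *\<^sub>R e)) has_real_derivative
      exp (- (k * r\<^sup>2) / 2) * avg (gauss1 e) g r (x + s *\<^sub>R e)) (at s)"
    using DERIV_cmult[OF avg_has_derivative[OF C C1 gauss_has_derivative g, of r x s], of "r * exp (- (k * r\<^sup>2) / 2)"] r
    by simp
  show "\<bar>exp (- (k * r\<^sup>2) / 2) * avg (gauss1 e) g r (x + s *\<^sub>R e)\<bar>
    \<le> exp (- (k * r\<^sup>2) / 2) * (M * (\<integral>z. \<bar>gauss1 e z\<bar> \<partial>lborel))"
    by (simp add: abs_mult avg_bound[OF C1 g])
qed simp

end

text \<open>The average of the constant 1 against \<open>gauss1 e\<close> does not depend on the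
  point, and its derivative along \<open>f\<close> is the integral in question.\<close>

lemma integral_gauss2: "(\<integral>z. gauss2 e f z \<partial>lborel) = 0"
proof -
  obtain C1 where C1: "gaussian_decay C1 (gauss1 e)" using gaussian_decay_gauss1 by blast
  obtain C2 where C2: "gaussian_decay C2 (gauss2 e f)" using gaussian_decay_gauss2 by blast
  have "((\<lambda>s. avg (gauss1 e) (\<lambda>_. 1) 1 (0 + s *\<^sub>R f)) has_real_derivative
      avg (gauss2 e f) (\<lambda>_. 1) 1 (0 + 0 *\<^sub>R f) / 1) (at 0)"
    by (rule avg_has_derivative[OF C1 C2 gauss1_has_derivative, where M = 1]) auto
  then have "((\<lambda>s. \<integral>z. gauss1 e z \<partial>lborel) has_real_derivative (\<integral>z. gauss2 e f z \<partial>lborel)) (at (0::real))"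
    by (simp add: avg_def)
  from DERIV_unique[OF this DERIV_const] show ?thesis .
qed

lemma gaussian_decay_integrable_norm:
  assumes "gaussian_decay C \<phi>"
  shows "integrable lborel (\<lambda>z. norm z * \<bar>\<phi> z\<bar>)"
proof (rule Bochner_Integration.integrable_bound)
  show "integrable lborel (\<lambda>z::'a. (2 * C) * exp (- (z \<bullet> z) / 8))"
    by (intro integrable_mult_right integrable_gaussian') simp
  have [measurable]: "\<phi> \<in> borel_measurable borel" by (rule gaussian_decay_measurable[OF assms])
  show "(\<lambda>z. norm z * \<bar>\<phi> z\<bar>) \<in> borel_measurable lborel" by measurable
  have C: "C \<ge> 0" by (rule gaussian_decay_nonneg[OF assms])
  have "norm (norm z * \<bar>\<phi> z\<bar>) \<le> (2 * C) * exp (- (z \<bullet> z) / 8)" for z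
  proof -
    have "norm z \<le> 2 * (1 + (z \<bullet> z) / 8)"
      using zero_le_power2[of "1 - norm z / 2"] by (simp add: power2_norm_eq_inner[symmetric] power2_eq_square field_simps)
    also have "\<dots> \<le> 2 * exp ((z \<bullet> z) / 8)" by (intro mult_left_mono exp_ge_add_one_self) auto
    finally have "norm z * \<bar>\<phi> z\<bar> \<le> 2 * exp ((z \<bullet> z) / 8) * (C * exp (- (z \<bullet> z) / 4))"
      using assms by (intro mult_mono) (auto simp: gaussian_decay_def)
    also have "\<dots> = (2 * C) * (exp ((z \<bullet> z) / 8) * exp (- (z \<bullet> z) / 4))" by simp
    also have "exp ((z \<bullet> z) / 8) * exp (- (z \<bullet> z) / 4) = exp (- (z \<bullet> z) / 8)"
      by (simp add: exp_add[symmetric])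
    finally show ?thesis by simp
  qed
  then show "AE z in lborel. norm (norm z * \<bar>\<phi> z\<bar>) \<le> norm ((2 * C) * exp (- (z \<bullet> z) / 8))"
    by (auto intro!: AE_I2 intro: order_trans[OF _ abs_ge_self])
qed

text \<open>The order of quantifiers is the point: \<open>K\<close> depends on \<open>k\<close>
  alone, so the resolvents of all data with a common bound share one Lipschitz constant. It comes
  from bounding \<open>resolvent1\<close> in the direction \<open>x - y\<close> and the mean value
  inequality on the segment.\<close>

lemma resolvent_lipschitz:
  assumes k: "k > 0"
  shows "\<exists>K\<ge>0. \<forall>(g::'a::euclidean_space \<Rightarrow> real) M. continuous_on UNIV g \<longrightarrow> (\<forall>y. \<bar>g y\<bar> \<le> M) \<longrightarrow>
    (\<forall>x y. \<bar>resolvent k g x - resolvent k g y\<bar> \<le> K * M * norm (x - y))"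
proof -
  define I where "I = (\<integral>r. exp (- (k * r\<^sup>2) / 2) \<partial>halfline)"
  define J where "J = (\<integral>z. norm z * \<bar>gauss (z::'a)\<bar> \<partial>lborel)"
  have I: "I \<ge> 0" and J: "J \<ge> 0" unfolding I_def J_def by (auto intro: integral_nonneg_AE)
  obtain C where C: "gaussian_decay C (gauss :: 'a \<Rightarrow> real)" using gaussian_decay_gauss by blast
  have gJ: "(\<integral>z. \<bar>gauss1 e z\<bar> \<partial>lborel) \<le> norm e * J" for e :: 'a
  proof -
    obtain C1 where C1: "gaussian_decay C1 (gauss1 e)" using gaussian_decay_gauss1 by blast
    have "(\<integral>z. \<bar>gauss1 e z\<bar> \<partial>lborel) \<le> (\<integral>z. norm e * (norm z * \<bar>gauss (z::'a)\<bar>) \<partial>lborel)"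
    proof (rule integral_mono)
      show "integrable lborel (\<lambda>z. \<bar>gauss1 e z\<bar>)" using gaussian_decay_integrable[OF C1] by (rule integrable_abs)
      show "integrable lborel (\<lambda>z. norm e * (norm z * \<bar>gauss (z::'a)\<bar>))"
        using gaussian_decay_integrable_norm[OF C] by (rule integrable_mult_right)
      show "\<bar>gauss1 e z\<bar> \<le> norm e * (norm z * \<bar>gauss z\<bar>)" for z
        using mult_right_mono[OF Cauchy_Schwarz_ineq2[of z e], of "\<bar>gauss z\<bar>"]
        by (simp add: gauss1_def abs_mult mult_ac)
    qed
    then show ?thesis by (simp add: J_def)
  qed
  show ?thesis
  proof (intro exI[of _ "I * J"] conjI allI impI)
    show "I * J \<ge> 0" using I J by simp
    fix g :: "'a \<Rightarrow> real" and M :: real and x y :: 'a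
    assume g0: "continuous_on UNIV g" "\<forall>y. \<bar>g y\<bar> \<le> M"
    then have g: "continuous_on UNIV g" "\<And>y. \<bar>g y\<bar> \<le> M" by auto
    have M: "M \<ge> 0" using g(2)[of 0] by linarith
    let ?e = "x - y"
    obtain C1 where C1: "gaussian_decay C1 (gauss1 ?e)" using gaussian_decay_gauss1 by blast
    have bound: "\<bar>resolvent1 k ?e g z\<bar> \<le> I * J * M * norm ?e" for z
    proof -
      have "\<bar>resolvent1 k ?e g z\<bar> \<le> (\<integral>r. \<bar>exp (- (k * r\<^sup>2) / 2) * avg (gauss1 ?e) g r z\<bar> \<partial>halfline)"
        unfolding resolvent1_def by (rule integral_abs_bound)
      also have "\<dots> \<le> (\<integral>r. exp (- (k * r\<^sup>2) / 2) * (M * (norm ?e * J)) \<partial>halfline)"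
      proof (rule integral_mono)
        show "integrable halfline (\<lambda>r. \<bar>exp (- (k * r\<^sup>2) / 2) * avg (gauss1 ?e) g r z\<bar>)"
          by (intro integrable_abs integrable_resolvent1[OF g k])
        show "integrable halfline (\<lambda>r. exp (- (k * r\<^sup>2) / 2) * (M * (norm ?e * J)))"
          by (intro integrable_mult_left integrable_halfline_gauss k)
        fix r
        have "\<bar>avg (gauss1 ?e) g r z\<bar> \<le> M * (norm ?e * J)"
          using avg_bound[OF C1 g, of r z] mult_left_mono[OF gJ[of ?e] M] by linarith
        then show "\<bar>exp (- (k * r\<^sup>2) / 2) * avg (gauss1 ?e) g r z\<bar> \<le> exp (- (k * r\<^sup>2) / 2) * (M * (norm ?e * J))"
          by (simp add: abs_mult)
      qed
      also have "\<dots> = I * (M * (norm ?e * J))" by (simp add: I_def)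
      finally show ?thesis by (simp add: mult_ac)
    qed
    have "norm (resolvent k g (y + 1 *\<^sub>R ?e) - resolvent k g (y + 0 *\<^sub>R ?e)) \<le> (I * J * M * norm ?e) * norm (1 - 0 :: real)"
    proof (rule field_differentiable_bound[where S = UNIV])
      show "((\<lambda>s. resolvent k g (y + s *\<^sub>R ?e)) has_real_derivative resolvent1 k ?e g (y + s *\<^sub>R ?e)) (at s within UNIV)" for s
        using resolvent_has_derivative[OF g k] by simp
      show "norm (resolvent1 k ?e g (y + s *\<^sub>R ?e)) \<le> I * J * M * norm ?e" for s
        using bound by simp
    qed auto
    then show "\<bar>resolvent k g x - resolvent k g y\<bar> \<le> I * J * M * norm (x - y)" by simp
  qed
qed

lemma resolvent_mono:
  fixes g h :: "'a::euclidean_space \<Rightarrow> real"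
  assumes k: "k > 0"
    and g: "continuous_on UNIV g" "\<And>y. \<bar>g y\<bar> \<le> M" and h: "continuous_on UNIV h" "\<And>y. \<bar>h y\<bar> \<le> M"
    and le: "\<And>y. g y \<le> h y"
  shows "resolvent k g x \<le> resolvent k h x"
  unfolding resolvent_def
proof (rule integral_mono)
  show "integrable halfline (\<lambda>r. (r * exp (- (k * r\<^sup>2) / 2)) * avg gauss g r x)"
    by (rule integrable_resolvent[OF g k])
  show "integrable halfline (\<lambda>r. (r * exp (- (k * r\<^sup>2) / 2)) * avg gauss h r x)"
    by (rule integrable_resolvent[OF h k])
  obtain C where C: "gaussian_decay C (gauss :: 'a \<Rightarrow> real)" using gaussian_decay_gauss by blast
  fix r assume "r \<in> space halfline"
  then have "r > 0" by simp
  moreover have "avg gauss g r x \<le> avg gauss h r x" unfolding avg_def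
    by (rule integral_mono[OF avg_integrable[OF C g] avg_integrable[OF C h]])
      (rule mult_left_mono[OF le less_imp_le[OF gauss_pos]])
  ultimately show "(r * exp (- (k * r\<^sup>2) / 2)) * avg gauss g r x \<le> (r * exp (- (k * r\<^sup>2) / 2)) * avg gauss h r x"
    by (intro mult_left_mono) auto
qed

text \<open>Strong maximum principle by infinite propagation speed: \<open>gauss\<close> is positive
  everywhere, so a vanishing resolvent forces \<open>h\<close> to vanish almost everywhere as seen
  from \<open>x\<close> at some scale \<open>r > 0\<close>, hence everywhere by continuity.\<close>

lemma resolvent_pos:
  fixes h :: "'a::euclidean_space \<Rightarrow> real"
  assumes k: "k > 0" and h: "continuous_on UNIV h" "\<And>y. \<bar>h y\<bar> \<le> M"
    and nonneg: "\<And>y. h y \<ge> 0" and pos: "h y0 > 0"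
  shows "resolvent k h x > 0"
proof (rule ccontr)
  obtain C where C: "gaussian_decay C (gauss :: 'a \<Rightarrow> real)" using gaussian_decay_gauss by blast
  have avg0: "avg gauss h r x \<ge> 0" for r
    unfolding avg_def using nonneg gauss_pos by (intro integral_nonneg_AE AE_I2 mult_nonneg_nonneg) (auto intro: less_imp_le)
  assume "\<not> resolvent k h x > 0"
  moreover have "resolvent k h x \<ge> 0"
    unfolding resolvent_def using avg0 by (intro integral_nonneg_AE AE_I2) auto
  ultimately have "resolvent k h x = 0" by simp
  then have "AE r in halfline. (r * exp (- (k * r\<^sup>2) / 2)) * avg gauss h r x = 0"
    unfolding resolvent_def
    by (subst (asm) integral_nonneg_eq_0_iff_AE[OF integrable_resolvent[OF h k]]) (use avg0 in auto)
  note ae = this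
  have not_null: "\<not> (AE r in halfline. False)"
  proof -
    have "emeasure lborel {0<..<1::real} \<le> emeasure lborel {0::real<..}" by (intro emeasure_mono) auto
    then have "emeasure lborel {0::real<..} \<noteq> 0" by auto
    then show ?thesis
      unfolding trivial_limit_def[symmetric] ae_filter_eq_bot_iff
      by (simp add: halfline_def emeasure_restrict_space space_restrict_space)
  qed
  obtain r where r: "r > 0" "(r * exp (- (k * r\<^sup>2) / 2)) * avg gauss h r x = 0"
  proof (rule ccontr)
    assume *: "\<not> thesis"
    have "AE r in halfline. False"
      using ae AE_space[of halfline] by eventually_elim (use * that in auto)
    with not_null show False ..
  qed
  then have "avg gauss h r x = 0" by simp
  then have "AE z in lborel. gauss z * h (x + r *\<^sub>R z) = 0"
    unfolding avg_def
    by (subst (asm) integral_nonneg_eq_0_iff_AE[OF avg_integrable[OF C h]])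
      (use nonneg gauss_pos in \<open>auto intro!: AE_I2 mult_nonneg_nonneg intro: less_imp_le\<close>)
  then have ae': "AE z in lborel. z \<in> {z. h (x + r *\<^sub>R z) = 0}"
    by eventually_elim simp
  \<comment> \<open>A closed set of full Lebesgue measure is the whole space; in particular it
    contains the \<open>z\<close> for which \<open>x + r *\<^sub>R z\<close> equals
    \<open>y0\<close>.\<close>
  have "AE z in lebesgue. z \<in> UNIV \<longrightarrow> z \<in> {z. h (x + r *\<^sub>R z) = 0}"
    using AE_completion[OF ae'] by simp
  moreover have "closed {z. h (x + r *\<^sub>R z) = 0}"
    by (rule closed_Collect_eq) (auto intro!: continuous_intros continuous_on_compose2[OF h(1)])
  ultimately have "(1 / r) *\<^sub>R (y0 - x) \<in> {z. h (x + r *\<^sub>R z) = 0}"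
    by (intro mem_closed_if_AE_lebesgue) simp_all
  then show False using r pos by simp
qed

context
  fixes g :: "'a::euclidean_space \<Rightarrow> real" and M L :: real
  assumes g: "continuous_on UNIV g" "\<And>y. \<bar>g y\<bar> \<le> M"
    and lip: "\<And>x y. \<bar>g x - g y\<bar> \<le> L * norm (x - y)"
begin

text \<open>Since \<open>gauss2\<close> has mean zero, \<open>g x\<close> can be subtracted inside
  the integral; the Lipschitz bound then yields the factor |r| that compensates the division by
  \<open>r\<close> in \<open>resolvent2\<close>.\<close>

lemma avg_gauss2_bound:
  "\<bar>avg (gauss2 e f) g r x\<bar> \<le> \<bar>r\<bar> * (L * (\<integral>z. norm z * \<bar>gauss2 e f z\<bar> \<partial>lborel))"
proof -
  obtain C where C: "gaussian_decay C (gauss2 e f)" using gaussian_decay_gauss2 by blast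
  note int = avg_integrable[OF C g, of x r] gaussian_decay_integrable[OF C]
  have "avg (gauss2 e f) g r x = (\<integral>z. gauss2 e f z * (g (x + r *\<^sub>R z) - g x) \<partial>lborel)"
    using int integral_gauss2[of e f] by (simp add: avg_def right_diff_distrib)
  also have "\<bar>\<dots>\<bar> \<le> (\<integral>z. \<bar>gauss2 e f z * (g (x + r *\<^sub>R z) - g x)\<bar> \<partial>lborel)"
    by (rule integral_abs_bound)
  also have "\<dots> \<le> (\<integral>z. (\<bar>r\<bar> * L) * (norm z * \<bar>gauss2 e f z\<bar>) \<partial>lborel)"
  proof (rule integral_mono)
    show "integrable lborel (\<lambda>z. \<bar>gauss2 e f z * (g (x + r *\<^sub>R z) - g x)\<bar>)"
      unfolding right_diff_distrib using int by (intro integrable_abs integrable_diff integrable_mult_left) auto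
    show "integrable lborel (\<lambda>z. (\<bar>r\<bar> * L) * (norm z * \<bar>gauss2 e f z\<bar>))"
      by (intro integrable_mult_right gaussian_decay_integrable_norm[OF C])
    show "\<bar>gauss2 e f z * (g (x + r *\<^sub>R z) - g x)\<bar> \<le> (\<bar>r\<bar> * L) * (norm z * \<bar>gauss2 e f z\<bar>)" for z
      using mult_left_mono[OF lip[of "x + r *\<^sub>R z" x], of "\<bar>gauss2 e f z\<bar>"]
      by (simp add: abs_mult mult_ac)
  qed
  finally show ?thesis by (simp add: mult_ac)
qed

lemma integrable_resolvent2:
  assumes "k > 0"
  shows "integrable halfline (\<lambda>r. exp (- (k * r\<^sup>2) / 2) * (avg (gauss2 e f) g r x / r))"
proof -
  obtain C where C: "gaussian_decay C (gauss2 e f)" using gaussian_decay_gauss2 by blast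
  have [measurable]: "(\<lambda>r. avg (gauss2 e f) g r x) \<in> borel_measurable borel"
    by (rule avg_measurable[OF C g])
  show ?thesis
    by (rule integrable_halfline_bounded_mult[OF integrable_halfline_gauss[OF assms],
          where K = "L * (\<integral>z. norm z * \<bar>gauss2 e f z\<bar> \<partial>lborel)"])
      (auto intro!: borel_measurable_halfline simp: divide_simps mult.commute
        intro: order_trans[OF avg_gauss2_bound])
qed

lemma resolvent1_has_derivative:
  assumes k: "k > 0"
  shows "((\<lambda>s. resolvent1 k e g (x + s *\<^sub>R f)) has_real_derivative resolvent2 k e f g (x + s0 *\<^sub>R f)) (at s0)"
  unfolding resolvent1_def resolvent2_def
proof (rule has_real_derivative_integral_dominated[where d = 1 and
      B = "\<lambda>r. exp (- (k * r\<^sup>2) / 2) * (L * (\<integral>z. norm z * \<bar>gauss2 e f z\<bar> \<partial>lborel))"])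
  obtain C where C: "gaussian_decay C (gauss1 e)" using gaussian_decay_gauss1 by blast
  obtain C1 where C1: "gaussian_decay C1 (gauss2 e f)" using gaussian_decay_gauss2 by blast
  show "integrable halfline (\<lambda>r. exp (- (k * r\<^sup>2) / 2) * (L * (\<integral>z. norm z * \<bar>gauss2 e f z\<bar> \<partial>lborel)))"
    by (intro integrable_mult_left integrable_halfline_gauss k)
  show "(\<lambda>r. exp (- (k * r\<^sup>2) / 2) * (avg (gauss2 e f) g r (x + s0 *\<^sub>R f) / r)) \<in> borel_measurable halfline"
    using integrable_resolvent2[OF k] by (rule borel_measurable_integrable)
  fix s :: real
  show "integrable halfline (\<lambda>r. exp (- (k * r\<^sup>2) / 2) * avg (gauss1 e) g r (x + s *\<^sub>R f))"
    by (rule integrable_resolvent1[OF g k])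
  fix r assume "r \<in> space halfline"
  then have r: "r > 0" by simp
  show "((\<lambda>s. exp (- (k * r\<^sup>2) / 2) * avg (gauss1 e) g r (x + s *\<^sub>R f)) has_real_derivative
      exp (- (k * r\<^sup>2) / 2) * (avg (gauss2 e f) g r (x + s *\<^sub>R f) / r)) (at s)"
    using r by (intro DERIV_cmult avg_has_derivative[OF C C1 gauss1_has_derivative g]) auto
  have "\<bar>avg (gauss2 e f) g r (x + s *\<^sub>R f) / r\<bar> \<le> L * (\<integral>z. norm z * \<bar>gauss2 e f z\<bar> \<partial>lborel)"
    using avg_gauss2_bound[of e f r "x + s *\<^sub>R f"] r by (simp add: divide_simps mult.commute)
  then show "\<bar>exp (- (k * r\<^sup>2) / 2) * (avg (gauss2 e f) g r (x + s *\<^sub>R f) / r)\<bar>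
    \<le> exp (- (k * r\<^sup>2) / 2) * (L * (\<integral>z. norm z * \<bar>gauss2 e f z\<bar> \<partial>lborel))"
    unfolding abs_mult abs_exp_cancel by (rule mult_left_mono) simp
qed simp

lemma continuous_on_resolvent1:
  assumes k: "k > 0"
  shows "continuous_on UNIV (resolvent1 k e g)"
  unfolding continuous_on_sequentially comp_def
proof (intro ballI allI impI)
  fix x and y :: "nat \<Rightarrow> 'a" assume "(\<forall>n. y n \<in> UNIV) \<and> y \<longlonglongrightarrow> x"
  then have y: "y \<longlonglongrightarrow> x" by simp
  obtain C where C: "gaussian_decay C (gauss1 e)" using gaussian_decay_gauss1 by blast
  show "(\<lambda>i. resolvent1 k e g (y i)) \<longlonglongrightarrow> resolvent1 k e g x"
    unfolding resolvent1_def
  proof (rule integral_dominated_convergence[where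
        w = "\<lambda>r. exp (- (k * r\<^sup>2) / 2) * (M * (\<integral>z. \<bar>gauss1 e z\<bar> \<partial>lborel))"])
    show "integrable halfline (\<lambda>r. exp (- (k * r\<^sup>2) / 2) * (M * (\<integral>z. \<bar>gauss1 e z\<bar> \<partial>lborel)))"
      by (intro integrable_mult_left integrable_halfline_gauss k)
    show "(\<lambda>r. exp (- (k * r\<^sup>2) / 2) * avg (gauss1 e) g r x) \<in> borel_measurable halfline"
      "\<And>i. (\<lambda>r. exp (- (k * r\<^sup>2) / 2) * avg (gauss1 e) g r (y i)) \<in> borel_measurable halfline"
      by (intro borel_measurable_integrable integrable_resolvent1[OF g k])+
    show "AE r in halfline. (\<lambda>i. exp (- (k * r\<^sup>2) / 2) * avg (gauss1 e) g r (y i))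
        \<longlonglongrightarrow> exp (- (k * r\<^sup>2) / 2) * avg (gauss1 e) g r x"
      by (intro AE_I2 tendsto_mult tendsto_const avg_tendsto[OF C g] y)
    show "AE r in halfline. norm (exp (- (k * r\<^sup>2) / 2) * avg (gauss1 e) g r (y i))
        \<le> exp (- (k * r\<^sup>2) / 2) * (M * (\<integral>z. \<bar>gauss1 e z\<bar> \<partial>lborel))" for i
      by (auto simp: abs_mult avg_bound[OF C g])
  qed
qed

lemma continuous_on_resolvent2:
  assumes k: "k > 0"
  shows "continuous_on UNIV (resolvent2 k e f g)"
  unfolding continuous_on_sequentially comp_def
proof (intro ballI allI impI)
  fix x and y :: "nat \<Rightarrow> 'a" assume "(\<forall>n. y n \<in> UNIV) \<and> y \<longlonglongrightarrow> x"
  then have y: "y \<longlonglongrightarrow> x" by simp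
  obtain C where C: "gaussian_decay C (gauss2 e f)" using gaussian_decay_gauss2 by blast
  show "(\<lambda>i. resolvent2 k e f g (y i)) \<longlonglongrightarrow> resolvent2 k e f g x"
    unfolding resolvent2_def
  proof (rule integral_dominated_convergence[where
        w = "\<lambda>r. exp (- (k * r\<^sup>2) / 2) * (L * (\<integral>z. norm z * \<bar>gauss2 e f z\<bar> \<partial>lborel))"])
    show "integrable halfline (\<lambda>r. exp (- (k * r\<^sup>2) / 2) * (L * (\<integral>z. norm z * \<bar>gauss2 e f z\<bar> \<partial>lborel)))"
      by (intro integrable_mult_left integrable_halfline_gauss k)
    show "(\<lambda>r. exp (- (k * r\<^sup>2) / 2) * (avg (gauss2 e f) g r x / r)) \<in> borel_measurable halfline"
      "\<And>i. (\<lambda>r. exp (- (k * r\<^sup>2) / 2) * (avg (gauss2 e f) g r (y i) / r)) \<in> borel_measurable halfline"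
      by (intro borel_measurable_integrable integrable_resolvent2[OF k])+
    show "AE r in halfline. (\<lambda>i. exp (- (k * r\<^sup>2) / 2) * (avg (gauss2 e f) g r (y i) / r))
        \<longlonglongrightarrow> exp (- (k * r\<^sup>2) / 2) * (avg (gauss2 e f) g r x / r)"
      by (intro AE_I2 tendsto_mult tendsto_divide tendsto_const avg_tendsto[OF C g] y) auto
    have "\<bar>avg (gauss2 e f) g r (y i) / r\<bar> \<le> L * (\<integral>z. norm z * \<bar>gauss2 e f z\<bar> \<partial>lborel)" if "r > 0" for r i
      using avg_gauss2_bound[of e f r "y i"] that by (simp add: divide_simps mult.commute)
    then show "AE r in halfline. norm (exp (- (k * r\<^sup>2) / 2) * (avg (gauss2 e f) g r (y i) / r))
        \<le> exp (- (k * r\<^sup>2) / 2) * (L * (\<integral>z. norm z * \<bar>gauss2 e f z\<bar> \<partial>lborel))" for i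
      unfolding real_norm_def abs_mult abs_exp_cancel by (auto intro!: AE_I2 mult_left_mono simp del: abs_divide)
  qed
qed

lemma avg_laplacian_kernel:
  "avg (\<lambda>z. (z \<bullet> z - DIM('a)) * gauss z) g r x = (\<Sum>e\<in>Basis. avg (gauss2 e e) g r x)"
proof -
  have int: "integrable lborel (\<lambda>z. gauss2 e e z * g (x + r *\<^sub>R z))" for e
    using gaussian_decay_gauss2[of e e] avg_integrable[OF _ g] by blast
  have "(z \<bullet> z - DIM('a)) * gauss z = (\<Sum>e\<in>Basis. gauss2 e e z)" for z :: 'a
    unfolding gauss2_def sum_distrib_right[symmetric]
    by (subst euclidean_inner[of z z]) (simp add: sum_subtractf)
  then show ?thesis
    by (simp add: avg_def sum_distrib_right Bochner_Integration.integral_sum int)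
qed

text \<open>By the heat equation for \<open>avg gauss\<close>, the function \<open>?F\<close> has
  derivative \<open>?f\<close>, the integrand of the Laplacian minus \<open>k\<close> applied to the
  resolvent. The fundamental theorem of calculus leaves the boundary values: \<open>g x\<close> at 0
  and 0 at infinity.\<close>

lemma resolvent_pde:
  assumes k: "k > 0"
  shows "k * resolvent k g x - (\<Sum>e\<in>Basis. resolvent2 k e e g x) = g x"
proof -
  obtain C where C: "gaussian_decay C (gauss :: 'a \<Rightarrow> real)" using gaussian_decay_gauss by blast
  let ?w = "\<lambda>r. exp (- (k * r\<^sup>2) / 2)"
  let ?F = "\<lambda>r. ?w r * avg gauss g r x"
  let ?f = "\<lambda>r. (\<Sum>e\<in>Basis. ?w r * (avg (gauss2 e e) g r x / r)) - k * ((r * ?w r) * avg gauss g r x)"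
  have int: "integrable halfline ?f"
    by (intro Bochner_Integration.integrable_diff Bochner_Integration.integrable_sum integrable_resolvent2[OF k]
        integrable_mult_right integrable_resolvent[OF g k])
  have "(LBINT r=ereal 0..\<infinity>. ?f r) = 0 - g x"
  proof (rule interval_integral_FTC_integrable)
    fix r assume "ereal 0 < ereal r" "ereal r < \<infinity>"
    then have r: "r > 0" by simp
    have "(?w has_real_derivative - (k * r) * ?w r) (at r)"
      by (auto intro!: derivative_eq_intros)
    moreover have "((\<lambda>r. avg gauss g r x) has_real_derivative (\<Sum>e\<in>Basis. avg (gauss2 e e) g r x) / r) (at r)"
      using avg_gauss_has_derivative_scale[OF g r, of x] unfolding avg_laplacian_kernel .
    ultimately have "(?F has_real_derivative
        (- (k * r) * ?w r) * avg gauss g r x + ((\<Sum>e\<in>Basis. avg (gauss2 e e) g r x) / r) * ?w r) (at r)"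
      by (rule DERIV_mult)
    then have "(?F has_real_derivative ?f r) (at r)"
      by (rule DERIV_cong) (simp add: sum_divide_distrib sum_distrib_left sum_distrib_right mult_ac)
    then show "(?F has_vector_derivative ?f r) (at r)"
      by (simp add: has_real_derivative_iff_has_vector_derivative)
    have cont: "isCont (\<lambda>r. avg \<phi> g r x) r" if "gaussian_decay K \<phi>" for K \<phi>
      using avg_continuous[OF that g] by (simp add: continuous_on_eq_continuous_at)
    have c2: "isCont (\<lambda>r. avg (gauss2 e e) g r x) r" for e
      using gaussian_decay_gauss2[of e e] cont by blast
    show "isCont ?f r"
      using r by (intro continuous_intros c2 cont[OF C]) auto
  next
    show "set_integrable lborel (einterval (ereal 0) \<infinity>) ?f"
      using int by (simp add: halfline_def integrable_restrict_space set_integrable_def)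
    have "isCont ?F 0"
      using avg_continuous[OF C g] by (intro continuous_intros) (auto simp: continuous_on_eq_continuous_at)
    then have "(?F \<longlongrightarrow> ?F 0) (at_right 0)"
      by (simp add: isCont_def filterlim_at_split)
    moreover have "?F 0 = g x" by (simp add: avg_def integral_gauss)
    ultimately show "((?F \<circ> real_of_ereal) \<longlongrightarrow> g x) (at_right (ereal 0))"
      by (simp add: ereal_tendsto_simps)
    have "(?F \<longlongrightarrow> 0) at_top"
    proof (rule Lim_null_comparison)
      show "\<forall>\<^sub>F r in at_top. norm (?F r) \<le> ?w r * (M * (\<integral>z. \<bar>gauss (z::'a)\<bar> \<partial>lborel))"
        by (intro always_eventually allI) (simp add: abs_mult avg_bound[OF C g])
      have "filterlim (\<lambda>r. (k / 2) * r\<^sup>2) at_top at_top"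
        using k by (intro filterlim_tendsto_pos_mult_at_top[OF tendsto_const] filterlim_pow_at_top filterlim_ident) auto
      then have "filterlim (\<lambda>r. - (k * r\<^sup>2) / 2) at_bot at_top"
        by (subst filterlim_uminus_at_bot) simp
      then have "(?w \<longlongrightarrow> 0) at_top" by (rule filterlim_compose[OF exp_at_bot])
      then show "((\<lambda>r. ?w r * (M * (\<integral>z. \<bar>gauss (z::'a)\<bar> \<partial>lborel))) \<longlongrightarrow> 0) at_top"
        by (rule tendsto_mult_left_zero)
    qed
    then show "((?F \<circ> real_of_ereal) \<longlongrightarrow> 0) (at_left \<infinity>)"
      by (simp add: ereal_tendsto_simps)
  qed simp
  then have "integral\<^sup>L halfline ?f = - g x"
    unfolding integral_halfline by (simp add: interval_integral_to_infinity_eq)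
  moreover have "integral\<^sup>L halfline ?f
      = (\<Sum>e\<in>Basis. resolvent2 k e e g x) - k * resolvent k g x"
  proof -
    have "integral\<^sup>L halfline ?f = (\<integral>r. (\<Sum>e\<in>Basis. ?w r * (avg (gauss2 e e) g r x / r)) \<partial>halfline)
        - (\<integral>r. k * ((r * ?w r) * avg gauss g r x) \<partial>halfline)"
      by (intro Bochner_Integration.integral_diff Bochner_Integration.integrable_sum integrable_resolvent2[OF k]
          integrable_mult_right integrable_resolvent[OF g k])
    also have "(\<integral>r. (\<Sum>e\<in>Basis. ?w r * (avg (gauss2 e e) g r x / r)) \<partial>halfline) = (\<Sum>e\<in>Basis. resolvent2 k e e g x)"
      unfolding resolvent2_def by (intro Bochner_Integration.integral_sum integrable_resolvent2[OF k])
    also have "(\<integral>r. k * ((r * ?w r) * avg gauss g r x) \<partial>halfline) = k * resolvent k g x"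
      unfolding resolvent_def by (rule integral_mult_right_zero)
    finally show ?thesis .
  qed
  ultimately show ?thesis by simp
qed

end

section \<open>The resolvent as a C^2 solution operator\<close>

lemma resolvent_partial_diff:
  fixes g :: "'a::euclidean_space \<Rightarrow> real"
  assumes g: "continuous_on UNIV g" "\<And>y. \<bar>g y\<bar> \<le> M" and k: "k > 0"
  shows "partial_diff e (resolvent k g) = resolvent1 k e g"
  unfolding partial_diff_def using DERIV_imp_deriv[OF resolvent_has_derivative[OF g k, of _ e 0]]
  by (simp add: fun_eq_iff)

lemma resolvent1_partial_diff:
  fixes g :: "'a::euclidean_space \<Rightarrow> real"
  assumes g: "continuous_on UNIV g" "\<And>y. \<bar>g y\<bar> \<le> M"
    and lip: "\<And>x y. \<bar>g x - g y\<bar> \<le> L * norm (x - y)" and k: "k > 0"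
  shows "partial_diff f (resolvent1 k e g) = resolvent2 k e f g"
  unfolding partial_diff_def using DERIV_imp_deriv[OF resolvent1_has_derivative[OF g lip k, of e _ f 0]]
  by (simp add: fun_eq_iff)

lemma continuous_on_resolvent:
  fixes g :: "'a::euclidean_space \<Rightarrow> real"
  assumes g: "continuous_on UNIV g" "\<And>y. \<bar>g y\<bar> \<le> M" and k: "k > 0"
  shows "continuous_on UNIV (resolvent k g)"
proof -
  obtain K where K: "K \<ge> 0" "\<And>x y. \<bar>resolvent k g x - resolvent k g y\<bar> \<le> K * M * norm (x - y)"
    using resolvent_lipschitz[OF k, where 'a = 'a] g by blast
  have "M \<ge> 0" using g(2)[of 0] by linarith
  then have "(K * M)-lipschitz_on UNIV (resolvent k g)"
    using K by (auto simp: lipschitz_on_def dist_norm)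
  then show ?thesis by (rule lipschitz_on_continuous_on)
qed

lemma C_diff_on_resolvent:
  fixes g :: "'a::euclidean_space \<Rightarrow> real"
  assumes g: "continuous_on UNIV g" "\<And>y. \<bar>g y\<bar> \<le> M"
    and lip: "\<And>x y. \<bar>g x - g y\<bar> \<le> L * norm (x - y)" and k: "k > 0"
  shows "C_diff_on 2 UNIV (resolvent k g)"
proof -
  have "(\<lambda>t. resolvent k g (x + t *\<^sub>R e)) differentiable at 0" for x e
    using resolvent_has_derivative[OF g k, of x e 0] by (auto simp: real_differentiable_def)
  moreover have "(\<lambda>t. resolvent1 k e g (x + t *\<^sub>R f)) differentiable at 0" for x e f
    using resolvent1_has_derivative[OF g lip k, of e x f 0] by (auto simp: real_differentiable_def)
  ultimately show ?thesis
    unfolding numeral_2_eq_2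
    by (auto simp: resolvent_partial_diff[OF g k] resolvent1_partial_diff[OF g lip k]
        continuous_on_resolvent[OF g k] continuous_on_resolvent1[OF g lip k] continuous_on_resolvent2[OF g lip k])
qed

lemma laplacian_resolvent:
  fixes g :: "'a::euclidean_space \<Rightarrow> real"
  assumes g: "continuous_on UNIV g" "\<And>y. \<bar>g y\<bar> \<le> M"
    and lip: "\<And>x y. \<bar>g x - g y\<bar> \<le> L * norm (x - y)" and k: "k > 0"
  shows "laplacian (resolvent k g) x = k * resolvent k g x - g x"
  using resolvent_pde[OF g lip k, of x]
  by (simp add: laplacian_def resolvent_partial_diff[OF g k] resolvent1_partial_diff[OF g lip k])

section \<open>Comparison\<close>

text \<open>L'Hopital's rule is applied once only; the remaining quotient is the mean of two
  difference quotients of \<open>f'\<close>, so a second derivative is needed at the point 0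
  alone.\<close>

lemma second_difference_tendsto:
  fixes f f' :: "real \<Rightarrow> real"
  assumes f: "\<forall>\<^sub>F s in nhds 0. (f has_real_derivative f' s) (at s)"
    and f': "(f' has_real_derivative q) (at 0)"
  shows "((\<lambda>s. (f s + f (- s) - 2 * f 0) / s\<^sup>2) \<longlongrightarrow> q) (at_right 0)"
proof (rule lhopital_right_0[where f' = "\<lambda>s. f' s - f' (- s)" and g' = "\<lambda>s. 2 * s"])
  have ev: "\<forall>\<^sub>F s in at_right 0. (f has_real_derivative f' s) (at s)"
    using f by (auto simp: eventually_at_filter elim: eventually_mono)
  have "filterlim uminus (nhds 0) (at_right (0::real))"
    using tendsto_minus[OF tendsto_ident_at[of "0::real" "{0<..}"]] by simp
  then have ev': "\<forall>\<^sub>F s in at_right 0. (f has_real_derivative f' (- s)) (at (- s))"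
    using f unfolding filterlim_iff by blast
  show "\<forall>\<^sub>F s in at_right 0. ((\<lambda>s. f s + f (- s) - 2 * f 0) has_real_derivative f' s - f' (- s)) (at s)"
    using ev ev'
  proof eventually_elim
    case (elim s)
    have "((\<lambda>s. f (- s)) has_real_derivative f' (- s) * (- 1)) (at s)"
      by (rule DERIV_chain2[where f = f and g = uminus, OF elim(2)]) (auto intro!: derivative_eq_intros)
    from DERIV_diff[OF DERIV_add[OF elim(1) this] DERIV_const] show ?case by simp
  qed
  show "\<forall>\<^sub>F s in at_right 0. ((\<lambda>s::real. s\<^sup>2) has_real_derivative 2 * s) (at s)"
    by (auto intro!: always_eventually derivative_eq_intros)
  show "\<forall>\<^sub>F s in at_right 0. s\<^sup>2 \<noteq> (0::real)" "\<forall>\<^sub>F s in at_right 0. 2 * s \<noteq> (0::real)"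
    by (auto simp: eventually_at_filter)
  have "(f has_real_derivative f' 0) (at 0)" using f by (rule eventually_nhds_x_imp_x)
  then have c: "isCont f 0" by (rule DERIV_isCont)
  have "isCont (\<lambda>s. f s + f (- s) - 2 * f 0) 0"
    using c by (auto intro!: continuous_intros isCont_o2[of 0 uminus f])
  then show "((\<lambda>s. f s + f (- s) - 2 * f 0) \<longlongrightarrow> 0) (at_right 0)"
    by (simp add: isCont_def filterlim_at_split)
  have "((\<lambda>s::real. s\<^sup>2) \<longlongrightarrow> 0\<^sup>2) (at_right 0)" by (intro tendsto_intros)
  then show "((\<lambda>s::real. s\<^sup>2) \<longlongrightarrow> 0) (at_right 0)" by simp
  have d: "((\<lambda>h. (f' h - f' 0) / h) \<longlongrightarrow> q) (at 0)"
    using f' by (simp add: DERIV_def)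
  then have d1: "((\<lambda>h. (f' h - f' 0) / h) \<longlongrightarrow> q) (at_right 0)" and d2: "((\<lambda>h. (f' h - f' 0) / h) \<longlongrightarrow> q) (at_left 0)"
    by (simp_all add: filterlim_at_split)
  have "((\<lambda>h. (f' (- h) - f' 0) / (- h)) \<longlongrightarrow> q) (at_right 0)"
    using d2 by (simp add: filterlim_at_left_to_right)
  from tendsto_mult_left[OF tendsto_add[OF d1 this], of "1 / 2"]
  have "((\<lambda>h. (1 / 2) * ((f' h - f' 0) / h + (f' (- h) - f' 0) / (- h))) \<longlongrightarrow> q) (at_right 0)" by simp
  moreover have "\<forall>\<^sub>F h in at_right 0. (1 / 2) * ((f' h - f' 0) / h + (f' (- h) - f' 0) / (- h)) = (f' h - f' (- h)) / (2 * h)"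
    by (auto simp: eventually_at_filter field_simps)
  ultimately show "((\<lambda>h. (f' h - f' (- h)) / (2 * h)) \<longlongrightarrow> q) (at_right 0)"
    by (rule Lim_transform_eventually)
qed

text \<open>A viscosity-type notion that allows concave corners, stated with symmetric second differences.\<close>

definition laplacian_le :: "('a::euclidean_space \<Rightarrow> real) \<Rightarrow> 'a \<Rightarrow> real \<Rightarrow> bool" where
  "laplacian_le v x c \<longleftrightarrow> (\<exists>q. (\<Sum>e\<in>Basis. q e) \<le> c \<and> (\<forall>e\<in>Basis. \<forall>\<eta>>0. \<forall>\<^sub>F s in at_right 0.
    v (x + s *\<^sub>R e) + v (x - s *\<^sub>R e) - 2 * v x \<le> (q e + \<eta>) * s\<^sup>2))"

text \<open>A function touching \<open>v\<close> from above at \<open>x\<close> has the larger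
  second differences there. Each smooth piece of a minimum can serve as such a function at the
  points where it is active.\<close>

lemma laplacian_leI:
  fixes v \<phi> :: "'a::euclidean_space \<Rightarrow> real"
  assumes le: "\<forall>\<^sub>F y in nhds x. v y \<le> \<phi> y" and eq: "v x = \<phi> x"
    and d1: "\<And>e. e \<in> Basis \<Longrightarrow> \<forall>\<^sub>F s in nhds 0. ((\<lambda>s. \<phi> (x + s *\<^sub>R e)) has_real_derivative \<phi>' e s) (at s)"
    and d2: "\<And>e. e \<in> Basis \<Longrightarrow> (\<phi>' e has_real_derivative q e) (at 0)"
    and q: "(\<Sum>e\<in>Basis. q e) \<le> c"
  shows "laplacian_le v x c"
  unfolding laplacian_le_def
proof (intro exI[of _ q] conjI ballI allI impI q)
  fix e :: 'a and \<eta> :: real assume e: "e \<in> Basis" and \<eta>: "\<eta> > 0"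
  have lim: "((\<lambda>s. x + (c * s) *\<^sub>R e) \<longlongrightarrow> x) (at_right (0::real))" for c
    by (auto intro!: tendsto_eq_intros)
  have up: "\<forall>\<^sub>F s in at_right 0. v (x + s *\<^sub>R e) \<le> \<phi> (x + s *\<^sub>R e)"
    using le lim[of 1] unfolding filterlim_iff by auto
  have down: "\<forall>\<^sub>F s in at_right 0. v (x - s *\<^sub>R e) \<le> \<phi> (x - s *\<^sub>R e)"
    using le lim[of "- 1"] unfolding filterlim_iff by auto
  have "\<forall>\<^sub>F s in at_right 0. (\<phi> (x + s *\<^sub>R e) + \<phi> (x + (- s) *\<^sub>R e) - 2 * \<phi> (x + 0 *\<^sub>R e)) / s\<^sup>2 < q e + \<eta>"
    using order_tendstoD(2)[OF second_difference_tendsto[OF d1[OF e] d2[OF e]], of "q e + \<eta>"] \<eta> by simp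
  then show "\<forall>\<^sub>F s in at_right 0. v (x + s *\<^sub>R e) + v (x - s *\<^sub>R e) - 2 * v x \<le> (q e + \<eta>) * s\<^sup>2"
    using up down eventually_at_right_less[of "0::real"]
  proof eventually_elim
    case (elim s)
    then have "\<phi> (x + s *\<^sub>R e) + \<phi> (x - s *\<^sub>R e) - 2 * \<phi> x \<le> (q e + \<eta>) * s\<^sup>2"
      by (simp add: pos_divide_less_eq)
    then show ?case using elim eq by linarith
  qed
qed

text \<open>A constant touches \<open>v\<close> from above at a maximum point; this disposes of all
  points where a barrier is capped.\<close>

lemma laplacian_le_const:
  assumes "\<And>y. v y \<le> v x" and "c \<ge> 0"
  shows "laplacian_le v x c"
  by (rule laplacian_leI[where \<phi> = "\<lambda>_. v x" and \<phi>' = "\<lambda>_ _. 0" and q = "\<lambda>_. 0"]) (use assms in auto)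

text \<open>The quadratic penalty compensates for the lack of compactness of the whole space.\<close>

lemma comparison:
  fixes w v :: "'a::euclidean_space \<Rightarrow> real"
  assumes k: "k > 0" and w: "continuous_on UNIV w" "\<And>x. \<bar>w x\<bar> \<le> M"
    and v: "continuous_on UNIV v" "\<And>x. \<bar>v x\<bar> \<le> M"
    and vle: "\<And>x. laplacian_le v x (c x)"
    and wq: "\<And>x e. e \<in> Basis \<Longrightarrow> ((\<lambda>s. (w (x + s *\<^sub>R e) + w (x - s *\<^sub>R e) - 2 * w x) / s\<^sup>2) \<longlongrightarrow> wq x e) (at_right 0)"
    and le: "\<And>x. k * w x - (\<Sum>e\<in>Basis. wq x e) \<le> k * v x - c x"
  shows "w x0 \<le> v x0"
proof (rule ccontr)
  assume "\<not> w x0 \<le> v x0"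
  define d where "d = w x0 - v x0"
  have d: "d > 0" using \<open>\<not> w x0 \<le> v x0\<close> by (simp add: d_def)
  \<comment> \<open>\<open>S\<close> collects the two costs of the penalty: its size at
    \<open>x0\<close>, and the \<open>2 * DIM('a) / k\<close> that its Laplacian contributes after
    division by \<open>k\<close>. The choice of \<delta> makes their total half of the supposed
    excess \<open>d\<close>.\<close>
  define S where "S = x0 \<bullet> x0 + 2 * DIM('a) / k"
  have S: "S > 0" using k by (auto simp: S_def intro!: add_nonneg_pos)
  define \<delta> where "\<delta> = d / (2 * S)"
  have \<delta>: "\<delta> > 0" using d S by (simp add: \<delta>_def)
  have \<delta>S: "\<delta> * S < d" using d S by (simp add: \<delta>_def)
  define \<Phi> where "\<Phi> x = w x - v x - \<delta> * (x \<bullet> x)" for x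
  have \<Phi>cont: "continuous_on A \<Phi>" for A
    unfolding \<Phi>_def by (intro continuous_intros continuous_on_subset[OF w(1)] continuous_on_subset[OF v(1)]) auto
  \<comment> \<open>Outside this ball the penalty exceeds \<open>2 * M\<close>, hence also
    \<open>w - v\<close>, and \<Phi> is negative; a maximum over the ball is therefore
    global.\<close>
  define R where "R = max (norm x0) (sqrt (2 * M / \<delta>))"
  have M: "M \<ge> 0" using w(2)[of 0] by linarith
  obtain xs where xs: "\<And>y. y \<in> cball 0 R \<Longrightarrow> \<Phi> y \<le> \<Phi> xs"
  proof -
    have "cball (0::'a) R \<noteq> {}" by (auto simp: R_def less_max_iff_disj not_less[symmetric])
    with continuous_attains_sup[OF compact_cball _ \<Phi>cont] that show ?thesis by blast
  qed
  have x0: "\<Phi> x0 \<le> \<Phi> xs" by (rule xs) (simp add: R_def)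
  have \<Phi>x0: "\<Phi> x0 > 0"
  proof -
    have "\<delta> * (x0 \<bullet> x0) + \<delta> * (2 * DIM('a) / k) < d" using \<delta>S by (simp add: S_def distrib_left)
    moreover have "\<delta> * (2 * DIM('a) / k) \<ge> 0" using \<delta> k by simp
    ultimately show ?thesis unfolding \<Phi>_def d_def by linarith
  qed
  have max: "\<Phi> y \<le> \<Phi> xs" for y
  proof (cases "y \<in> cball 0 R")
    case False
    then have "sqrt (2 * M / \<delta>) < norm y" by (simp add: R_def)
    then have "(sqrt (2 * M / \<delta>))\<^sup>2 < (norm y)\<^sup>2"
      using M \<delta> by (intro power_strict_mono) auto
    then have "2 * M / \<delta> < (norm y)\<^sup>2" using M \<delta> by simp
    then have "2 * M < \<delta> * (y \<bullet> y)" using \<delta> by (simp add: pos_divide_less_eq power2_norm_eq_inner mult.commute)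
    then have "\<Phi> y < 0" using w(2)[of y] v(2)[of y] unfolding \<Phi>_def by linarith
    then show ?thesis using x0 \<Phi>x0 by linarith
  qed (rule xs)
  obtain q where q: "(\<Sum>e\<in>Basis. q e) \<le> c xs" and
    qle: "\<And>e \<eta>. e \<in> Basis \<Longrightarrow> \<eta> > 0 \<Longrightarrow> \<forall>\<^sub>F s in at_right 0.
      v (xs + s *\<^sub>R e) + v (xs - s *\<^sub>R e) - 2 * v xs \<le> (q e + \<eta>) * s\<^sup>2"
    using vle[of xs] unfolding laplacian_le_def by blast
  \<comment> \<open>Second differences of \<Phi> at its maximum are nonpositive, and those of the
    penalty equal \<open>2 * \<delta> * s\<^sup>2\<close> in every coordinate direction.\<close>
  have wle: "wq xs e \<le> q e + 2 * \<delta>" if e: "e \<in> Basis" for e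
  proof (rule field_le_epsilon)
    fix \<eta> :: real assume \<eta>: "\<eta> > 0"
    have "\<forall>\<^sub>F s in at_right 0. (w (xs + s *\<^sub>R e) + w (xs - s *\<^sub>R e) - 2 * w xs) / s\<^sup>2 \<le> q e + 2 * \<delta> + \<eta>"
      using qle[OF e \<eta>] eventually_at_right_less[of "0::real"]
    proof eventually_elim
      case (elim s)
      have "e \<bullet> e = 1" using e by (simp add: inner_same_Basis)
      then have sq: "(xs + s *\<^sub>R e) \<bullet> (xs + s *\<^sub>R e) + (xs - s *\<^sub>R e) \<bullet> (xs - s *\<^sub>R e) = 2 * (xs \<bullet> xs) + 2 * s\<^sup>2"
        by (simp add: inner_add_left inner_add_right inner_diff_left inner_diff_right power2_eq_square algebra_simps)
      have "\<delta> * ((xs + s *\<^sub>R e) \<bullet> (xs + s *\<^sub>R e)) + \<delta> * ((xs - s *\<^sub>R e) \<bullet> (xs - s *\<^sub>R e))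
        = 2 * (\<delta> * (xs \<bullet> xs)) + 2 * \<delta> * s\<^sup>2"
        unfolding distrib_left[symmetric] sq by (simp add: algebra_simps)
      then have "w (xs + s *\<^sub>R e) + w (xs - s *\<^sub>R e) - 2 * w xs \<le> (q e + \<eta>) * s\<^sup>2 + 2 * \<delta> * s\<^sup>2"
        using elim(1) max[of "xs + s *\<^sub>R e"] max[of "xs - s *\<^sub>R e"] unfolding \<Phi>_def by linarith
      also have "\<dots> = (q e + 2 * \<delta> + \<eta>) * s\<^sup>2" by (simp add: algebra_simps)
      finally show ?case using elim(2) by (simp add: pos_divide_le_eq)
    qed
    then show "wq xs e \<le> q e + 2 * \<delta> + \<eta>"
      by (rule tendsto_upperbound[OF wq[OF e]]) simp
  qed
  have "(\<Sum>e\<in>Basis. wq xs e) \<le> (\<Sum>e\<in>Basis. q e + 2 * \<delta>)" by (rule sum_mono) (rule wle)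
  also have "\<dots> \<le> c xs + 2 * \<delta> * DIM('a)" using q by (simp add: sum.distrib)
  finally have "k * w xs \<le> k * v xs + 2 * \<delta> * DIM('a)" using le[of xs] by linarith
  then have "w xs - v xs \<le> \<delta> * (2 * DIM('a) / k)" using k by (simp add: field_simps)
  moreover have "\<delta> * (xs \<bullet> xs) \<ge> 0" using \<delta> by simp
  ultimately have "\<Phi> xs \<le> \<delta> * (2 * DIM('a) / k)" unfolding \<Phi>_def by linarith
  with x0 have "d \<le> \<delta> * S" unfolding \<Phi>_def S_def d_def by (simp add: distrib_left)
  then show False using \<delta>S by simp
qed

lemma resolvent_bounded:
  fixes g :: "'a::euclidean_space \<Rightarrow> real"
  assumes g: "continuous_on UNIV g" "\<And>y. \<bar>g y\<bar> \<le> M" and k: "k > 0"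
  shows "\<exists>B. \<forall>x. \<bar>resolvent k g x\<bar> \<le> B"
proof (intro exI allI)
  obtain C where C: "gaussian_decay C (gauss :: 'a \<Rightarrow> real)" using gaussian_decay_gauss by blast
  fix x
  let ?B = "M * (\<integral>z. \<bar>gauss (z::'a)\<bar> \<partial>lborel)"
  have "\<bar>resolvent k g x\<bar> \<le> (\<integral>r. \<bar>(r * exp (- (k * r\<^sup>2) / 2)) * avg gauss g r x\<bar> \<partial>halfline)"
    unfolding resolvent_def by (rule integral_abs_bound)
  also have "\<dots> \<le> (\<integral>r. (r * exp (- (k * r\<^sup>2) / 2)) * ?B \<partial>halfline)"
  proof (rule integral_mono)
    show "integrable halfline (\<lambda>r. \<bar>(r * exp (- (k * r\<^sup>2) / 2)) * avg gauss g r x\<bar>)"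
      by (intro integrable_abs integrable_resolvent[OF g k])
    show "integrable halfline (\<lambda>r. (r * exp (- (k * r\<^sup>2) / 2)) * ?B)"
      by (intro integrable_mult_left integrable_halfline_gauss_moment k)
    fix r assume "r \<in> space halfline"
    then have "r > 0" by simp
    then show "\<bar>(r * exp (- (k * r\<^sup>2) / 2)) * avg gauss g r x\<bar> \<le> (r * exp (- (k * r\<^sup>2) / 2)) * ?B"
      unfolding abs_mult using avg_bound[OF C g, of r x] by (simp add: mult_left_mono)
  qed
  finally show "\<bar>resolvent k g x\<bar> \<le> (\<integral>r. (r * exp (- (k * r\<^sup>2) / 2)) * ?B \<partial>halfline)" .
qed

text \<open>Second derivatives vanish by \<open>integral_gauss2\<close>, so the equation determines
  the value. This is what allows a fixed point to be compared with the constants \<open>a\<close>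
  and \<open>b\<close>.\<close>

lemma resolvent_const:
  assumes "k > 0"
  shows "k * resolvent k (\<lambda>_. c) (x::'a::euclidean_space) = c"
proof -
  have "resolvent2 k e e (\<lambda>_::'a. c) x = 0" for e
    using integral_gauss2[of e e] by (simp add: resolvent2_def avg_def)
  then show ?thesis
    using resolvent_pde[of "\<lambda>_::'a. c" "\<bar>c\<bar>" 0 k x] assms by simp
qed

lemma resolvent_strict_mono:
  fixes g h :: "'a::euclidean_space \<Rightarrow> real"
  assumes k: "k > 0"
    and g: "continuous_on UNIV g" "\<And>y. \<bar>g y\<bar> \<le> M" and h: "continuous_on UNIV h" "\<And>y. \<bar>h y\<bar> \<le> M"
    and le: "\<And>y. g y \<le> h y" and less: "g y0 < h y0"
  shows "resolvent k g x < resolvent k h x"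
proof -
  obtain C where C: "gaussian_decay C (gauss :: 'a \<Rightarrow> real)" using gaussian_decay_gauss by blast
  have bnd: "\<bar>h y - g y\<bar> \<le> 2 * M" for y using g(2)[of y] h(2)[of y] by linarith
  have cont: "continuous_on UNIV (\<lambda>y. h y - g y)" by (intro continuous_on_diff g h)
  have pos: "resolvent k (\<lambda>y. h y - g y) x > 0"
    by (rule resolvent_pos[OF k cont bnd, of y0]) (use le less in auto)
  have "resolvent k (\<lambda>y. h y - g y) x = resolvent k h x - resolvent k g x"
  proof -
    have "avg gauss (\<lambda>y. h y - g y) r x = avg gauss h r x - avg gauss g r x" for r
      unfolding avg_def right_diff_distrib
      by (rule Bochner_Integration.integral_diff[OF avg_integrable[OF C h] avg_integrable[OF C g]])
    then show ?thesis
      unfolding resolvent_def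
      by (simp only: right_diff_distrib Bochner_Integration.integral_diff[OF integrable_resolvent[OF h k] integrable_resolvent[OF g k]])
  qed
  then show ?thesis using pos by simp
qed

text \<open>Second differences of the resolvent converge to \<open>resolvent2\<close>, so only the
  barrier has to be treated in the weak sense. The lower bound is the comparison principle for the
  negated functions.\<close>

lemma resolvent_comparison:
  fixes g v :: "'a::euclidean_space \<Rightarrow> real"
  assumes k: "k > 0" and g: "continuous_on UNIV g" "\<And>y. \<bar>g y\<bar> \<le> M"
    and lip: "\<And>x y. \<bar>g x - g y\<bar> \<le> L * norm (x - y)"
    and v: "continuous_on UNIV v" "\<And>x. \<bar>v x\<bar> \<le> N"
  shows resolvent_le: "\<lbrakk>\<And>x. laplacian_le v x (c x); \<And>x. g x \<le> k * v x - c x\<rbrakk> \<Longrightarrow> resolvent k g x \<le> v x"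
    and resolvent_ge: "\<lbrakk>\<And>x. laplacian_le (\<lambda>y. - v y) x (- c x); \<And>x. g x \<ge> k * v x - c x\<rbrakk> \<Longrightarrow> resolvent k g x \<ge> v x"
proof -
  obtain B where B: "\<And>x. \<bar>resolvent k g x\<bar> \<le> B" using resolvent_bounded[OF g k] by blast
  let ?w = "resolvent k g"
  have lim: "((\<lambda>s. (?w (x + s *\<^sub>R e) + ?w (x - s *\<^sub>R e) - 2 * ?w x) / s\<^sup>2) \<longlongrightarrow> resolvent2 k e e g x) (at_right 0)" for x e
  proof -
    have "((\<lambda>s. (?w (x + s *\<^sub>R e) + ?w (x + (- s) *\<^sub>R e) - 2 * ?w (x + 0 *\<^sub>R e)) / s\<^sup>2)
        \<longlongrightarrow> resolvent2 k e e g (x + 0 *\<^sub>R e)) (at_right 0)"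
      by (rule second_difference_tendsto[OF always_eventually resolvent1_has_derivative[OF g lip k]])
        (use resolvent_has_derivative[OF g k] in blast)
    then show ?thesis by simp
  qed
  show "?w x \<le> v x" if "\<And>x. laplacian_le v x (c x)" "\<And>x. g x \<le> k * v x - c x"
  proof (rule comparison[OF k continuous_on_resolvent[OF g k] _ v(1) _ that(1) lim])
    show "\<bar>?w x\<bar> \<le> max B N" "\<bar>v x\<bar> \<le> max B N" for x using B[of x] v(2)[of x] by linarith+
    show "k * ?w x - (\<Sum>e\<in>Basis. resolvent2 k e e g x) \<le> k * v x - c x" for x
      using resolvent_pde[OF g lip k, of x] that(2)[of x] by simp
  qed
  show "?w x \<ge> v x" if "\<And>x. laplacian_le (\<lambda>y. - v y) x (- c x)" "\<And>x. g x \<ge> k * v x - c x"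
  proof -
    have "- ?w x \<le> - v x"
    proof (rule comparison[OF k _ _ _ _ that(1), where wq = "\<lambda>x e. - resolvent2 k e e g x"])
      show "continuous_on UNIV (\<lambda>x. - ?w x)" "continuous_on UNIV (\<lambda>x. - v x)"
        using continuous_on_resolvent[OF g k] v(1) by (auto intro: continuous_on_minus)
      show "\<bar>- ?w x\<bar> \<le> max B N" "\<bar>- v x\<bar> \<le> max B N" for x using B[of x] v(2)[of x] by linarith+
      show "k * - ?w x - (\<Sum>e\<in>Basis. - resolvent2 k e e g x) \<le> k * - v x - - c x" for x
        using resolvent_pde[OF g lip k, of x] that(2)[of x] by (simp add: sum_negf)
      show "((\<lambda>s. (- ?w (x + s *\<^sub>R e) + - ?w (x - s *\<^sub>R e) - 2 * - ?w x) / s\<^sup>2) \<longlongrightarrow> - resolvent2 k e e g x) (at_right 0)" for x e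
        using tendsto_minus[OF lim[of x e]] by (rule Lim_transform_eventually) (auto simp: field_simps diff_divide_distrib add_divide_distrib)
    qed
    then show ?thesis by simp
  qed
qed

section \<open>Sub- and supersolutions\<close>

text \<open>Knaster-Tarski in the pointwise order: the supremum of all \<open>w \<le> T w\<close> is
  a fixed point. Infima provide a least element of \<open>S\<close>, which shows that there is such
  a \<open>w\<close>; the bound \<open>B\<close> makes real suprema and infima meaningful.\<close>

lemma Sup_mono_fixed_point:
  fixes S :: "('a \<Rightarrow> real) set" and T :: "('a \<Rightarrow> real) \<Rightarrow> ('a \<Rightarrow> real)"
  assumes ne: "S \<noteq> {}" and bnd: "\<And>u x. u \<in> S \<Longrightarrow> \<bar>u x\<bar> \<le> B"
    and sup: "\<And>Q. Q \<noteq> {} \<Longrightarrow> Q \<subseteq> S \<Longrightarrow> (\<lambda>x. SUP u\<in>Q. u x) \<in> S"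
    and inf: "\<And>Q. Q \<noteq> {} \<Longrightarrow> Q \<subseteq> S \<Longrightarrow> (\<lambda>x. INF u\<in>Q. u x) \<in> S"
    and T: "\<And>u. u \<in> S \<Longrightarrow> T u \<in> S"
    and mono: "\<And>u v. u \<in> S \<Longrightarrow> v \<in> S \<Longrightarrow> u \<le> v \<Longrightarrow> T u \<le> T v"
  obtains u where "u \<in> S" "T u = u"
proof -
  have bnd': "- B \<le> u x" "u x \<le> B" if "u \<in> S" for u x
    using bnd[OF that, of x] by linarith+
  have above: "bdd_above ((\<lambda>u. u x) ` Q)" if "Q \<subseteq> S" for Q x
    using that bnd'(2) by (intro bdd_aboveI2) blast
  have below: "bdd_below ((\<lambda>u. u x) ` Q)" if "Q \<subseteq> S" for Q x
    using that bnd'(1) by (intro bdd_belowI2) blast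
  define P where "P = {u \<in> S. u \<le> T u}"
  define m where "m = (\<lambda>x. INF u\<in>S. u x)"
  have m: "m \<in> S" unfolding m_def using ne by (intro inf) auto
  have mle: "m \<le> u" if "u \<in> S" for u
    using that below[of S] by (auto simp: m_def le_fun_def intro: cINF_lower)
  have "m \<in> P" using m mle[OF T[OF m]] by (simp add: P_def)
  then have P: "P \<noteq> {}" "P \<subseteq> S" by (auto simp: P_def)
  define u where "u = (\<lambda>x. SUP u\<in>P. u x)"
  have u: "u \<in> S" unfolding u_def using P by (rule sup)
  have le_u: "w \<le> u" if "w \<in> P" for w
    using that above[OF P(2)] by (auto simp: u_def le_fun_def intro: cSUP_upper)
  have "w \<le> T u" if "w \<in> P" for w
    using that mono[of w u] le_u[of w] u by (auto simp: P_def intro: order_trans)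
  then have uT: "u \<le> T u" using P(1) by (auto simp: u_def le_fun_def intro!: cSUP_least)
  then have "T u \<in> P" using mono[OF u T[OF u]] T[OF u] by (simp add: P_def)
  then have "T u \<le> u" by (rule le_u)
  with uT u show ?thesis by (intro that[of u]) auto
qed

text \<open>\<open>w0\<close> supplies a Lipschitz member of the lattice, as \<open>lo\<close> and
  \<open>hi\<close> are merely continuous. By \<open>Fa\<close> and \<open>Fb\<close> the constants
  \<open>a\<close> and \<open>b\<close> are themselves a sub- and a supersolution;
  \<open>lo_ne\<close> and \<open>hi_ne\<close> separate \<open>u\<close> from them at one point,
  and strict positivity of the resolvent spreads this to all points.\<close>

theorem sub_supersolution:
  fixes F :: "'a::euclidean_space \<Rightarrow> real \<Rightarrow> real" and lo hi w0 :: "'a \<Rightarrow> real"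
  assumes F_lip: "\<And>x y s t. s \<in> {a..b} \<Longrightarrow> t \<in> {a..b} \<Longrightarrow> \<bar>F x s - F y t\<bar> \<le> \<Lambda> * (norm (x - y) + \<bar>s - t\<bar>)"
    and F_bnd: "\<And>x s. s \<in> {a..b} \<Longrightarrow> \<bar>F x s\<bar> \<le> N"
    and Fa: "\<And>x. F x a \<le> 0" and Fb: "\<And>x. F x b \<ge> 0"
    and a_lo: "\<And>x. a \<le> lo x" and hi_b: "\<And>x. hi x \<le> b"
    and lo_ne: "lo y1 > a" and hi_ne: "hi y2 < b"
    and lo: "continuous_on UNIV lo" "\<And>x. laplacian_le (\<lambda>y. - lo y) x (- F x (lo x))"
    and hi: "continuous_on UNIV hi" "\<And>x. laplacian_le hi x (F x (hi x))"
    and w0: "\<And>x. lo x \<le> w0 x" "\<And>x. w0 x \<le> hi x" "\<And>x y. \<bar>w0 x - w0 y\<bar> \<le> L0 * norm (x - y)"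
  obtains u where "C_diff_on 2 UNIV u" "\<And>x. laplacian u x = F x (u x)"
    "\<And>x. lo x \<le> u x" "\<And>x. u x \<le> hi x" "\<And>x. a < u x" "\<And>x. u x < b"
proof -
  have lo_hi: "lo x \<le> hi x" for x using w0(1,2)[of x] by linarith
  have ab: "a < b" using lo_ne hi_b[of y1] lo_hi[of y1] by linarith
  have \<Lambda>: "\<Lambda> \<ge> 0"
    using order_trans[OF abs_ge_zero F_lip[of a b 0 0]] ab by (simp add: zero_le_mult_iff)
  \<comment> \<open>With one more than the Lipschitz constant, \<open>k * s - F x s\<close>
    increases in \<open>s\<close> with slope at least 1: this gives monotonicity of
    \<open>T\<close>, and strictness in the comparison with \<open>a\<close> and
    \<open>b\<close>.\<close>
  define k where "k = \<Lambda> + 1"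
  have k: "k > 0" using \<Lambda> by (simp add: k_def)
  define f where "f x s = k * s - F x s" for x s
  have f_mono: "f x t - f x s \<ge> t - s" if "s \<in> {a..b}" "t \<in> {a..b}" "s \<le> t" for x s t
    using F_lip[OF that(1,2), of x x] that(3) by (simp add: f_def k_def algebra_simps)
  define B where "B = k * max \<bar>a\<bar> \<bar>b\<bar> + N"
  have f_bnd: "\<bar>f x s\<bar> \<le> B" if "s \<in> {a..b}" for x s
  proof -
    have "\<bar>s\<bar> \<le> max \<bar>a\<bar> \<bar>b\<bar>" using that by auto
    then have "\<bar>k * s\<bar> \<le> k * max \<bar>a\<bar> \<bar>b\<bar>" using k by (simp add: abs_mult)
    then show ?thesis using F_bnd[OF that, of x] unfolding f_def B_def by linarith
  qed
  have B: "B \<ge> 0" using f_bnd[of a 0] ab by simp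
  obtain K where K: "K \<ge> 0" and K_lip: "\<And>(g::'a \<Rightarrow> real) M x y. continuous_on UNIV g \<Longrightarrow> (\<And>y. \<bar>g y\<bar> \<le> M) \<Longrightarrow>
      \<bar>resolvent k g x - resolvent k g y\<bar> \<le> K * M * norm (x - y)"
    using resolvent_lipschitz[OF k, where 'a = 'a] by blast
  \<comment> \<open>\<open>K * B\<close> bounds the Lipschitz constant of every \<open>T u\<close>,
    whatever that of \<open>u\<close>; \<open>L0\<close> admits \<open>w0\<close>.\<close>
  define L where "L = max L0 (K * B)"
  have L: "L \<ge> 0" using K B by (simp add: L_def le_max_iff_disj)
  \<comment> \<open>The one-sided form of the Lipschitz condition, over all ordered pairs, passes
    directly to suprema and infima.\<close>
  define S where "S = {u :: 'a \<Rightarrow> real. (\<forall>x. lo x \<le> u x \<and> u x \<le> hi x) \<and> (\<forall>x y. u x \<le> u y + L * norm (x - y))}"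
  have S_ab: "u x \<in> {a..b}" if "u \<in> S" for u x
    using that a_lo[of x] hi_b[of x] by (auto simp: S_def intro: order_trans)
  have S_lo: "lo x \<le> u x" and S_hi: "u x \<le> hi x" if "u \<in> S" for u x
    using that by (auto simp: S_def)
  define G where "G u = (\<lambda>x. f x (u x))" for u
  \<comment> \<open>This constant may exceed \<open>L\<close>, which is harmless: it only grants
    second derivatives of \<open>T u\<close> and is not fed back into the lattice.\<close>
  have G_lip: "\<bar>G u x - G u y\<bar> \<le> (k * L + \<Lambda> * (1 + L)) * norm (x - y)" if u: "u \<in> S" for u x y
  proof -
    have d: "\<bar>u x - u y\<bar> \<le> L * norm (x - y)"
    proof -
      have "u x \<le> u y + L * norm (x - y)" "u y \<le> u x + L * norm (y - x)"
        using u unfolding S_def by auto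
      then show ?thesis unfolding norm_minus_commute[of y x] by linarith
    qed
    have "\<bar>G u x - G u y\<bar> \<le> \<bar>k * (u x - u y)\<bar> + \<bar>F x (u x) - F y (u y)\<bar>"
      by (simp add: G_def f_def algebra_simps)
    also have "\<bar>k * (u x - u y)\<bar> \<le> k * (L * norm (x - y))" using d k by (simp add: abs_mult)
    also have "\<bar>F x (u x) - F y (u y)\<bar> \<le> \<Lambda> * (norm (x - y) + \<bar>u x - u y\<bar>)"
      by (intro F_lip S_ab u)
    also have "\<dots> \<le> \<Lambda> * (norm (x - y) + L * norm (x - y))" using d \<Lambda> by (intro mult_left_mono) auto
    finally show ?thesis by (simp add: algebra_simps)
  qed
  have G_cont: "continuous_on UNIV (G u)" if "u \<in> S" for u
    using G_lip[OF that] L k \<Lambda>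
    by (intro lipschitz_on_continuous_on[of "k * L + \<Lambda> * (1 + L)"]) (auto simp: lipschitz_on_def dist_norm)
  have G_bnd: "\<bar>G u y\<bar> \<le> B" if "u \<in> S" for u y
    unfolding G_def by (rule f_bnd[OF S_ab[OF that]])
  define T where "T u = resolvent k (G u)" for u
  have bnd_ab: "\<bar>s\<bar> \<le> max \<bar>a\<bar> \<bar>b\<bar>" if "s \<in> {a..b}" for s using that by auto
  have lo_ab: "lo x \<in> {a..b}" and hi_ab: "hi x \<in> {a..b}" for x
    using a_lo[of x] hi_b[of x] lo_hi[of x] by auto
  have "w0 \<in> S"
  proof -
    have "w0 x \<le> w0 y + L * norm (x - y)" for x y
    proof -
      have "L0 * norm (x - y) \<le> L * norm (x - y)" by (intro mult_right_mono) (auto simp: L_def)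
      then show ?thesis using w0(3)[of x y] by linarith
    qed
    then show ?thesis using w0 by (simp add: S_def)
  qed
  obtain u where u: "u \<in> S" "T u = u"
  proof (rule Sup_mono_fixed_point[of S "max \<bar>a\<bar> \<bar>b\<bar>" T])
    show "S \<noteq> {}" using \<open>w0 \<in> S\<close> by blast
    show "\<bar>u x\<bar> \<le> max \<bar>a\<bar> \<bar>b\<bar>" if "u \<in> S" for u x using S_ab[OF that] by (rule bnd_ab)
    show "(\<lambda>x. SUP u\<in>Q. u x) \<in> S" if Q: "Q \<noteq> {}" "Q \<subseteq> S" for Q
    proof -
      have bdd: "bdd_above ((\<lambda>u. u x) ` Q)" for x
        using Q S_ab by (auto simp: bdd_above_def intro!: exI[of _ b])
      obtain u0 where u0: "u0 \<in> Q" using Q by blast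
      have "lo x \<le> (SUP u\<in>Q. u x)" for x
        by (rule cSUP_upper2[OF bdd u0]) (use u0 Q in \<open>auto simp: S_def\<close>)
      moreover have "(SUP u\<in>Q. u x) \<le> hi x" for x
        by (rule cSUP_least) (use Q in \<open>auto simp: S_def\<close>)
      moreover have "(SUP u\<in>Q. u x) \<le> (SUP u\<in>Q. u y) + L * norm (x - y)" for x y
      proof (rule cSUP_least[OF Q(1)])
        fix u assume "u \<in> Q"
        then have "u x \<le> u y + L * norm (x - y)" "u y \<le> (SUP u\<in>Q. u y)"
          using Q by (auto simp: S_def intro: cSUP_upper[OF _ bdd])
        then show "u x \<le> (SUP u\<in>Q. u y) + L * norm (x - y)" by linarith
      qed
      ultimately show ?thesis by (simp add: S_def)
    qed
    show "(\<lambda>x. INF u\<in>Q. u x) \<in> S" if Q: "Q \<noteq> {}" "Q \<subseteq> S" for Q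
    proof -
      have bdd: "bdd_below ((\<lambda>u. u x) ` Q)" for x
        using Q S_ab by (auto simp: bdd_below_def intro!: exI[of _ a])
      obtain u0 where u0: "u0 \<in> Q" using Q by blast
      have "(INF u\<in>Q. u x) \<le> hi x" for x
        by (rule cINF_lower2[OF bdd u0]) (use u0 Q in \<open>auto simp: S_def\<close>)
      moreover have "lo x \<le> (INF u\<in>Q. u x)" for x
        by (rule cINF_greatest) (use Q in \<open>auto simp: S_def\<close>)
      moreover have "(INF u\<in>Q. u x) \<le> (INF u\<in>Q. u y) + L * norm (x - y)" for x y
      proof -
        have "(INF u\<in>Q. u x) - L * norm (x - y) \<le> (INF u\<in>Q. u y)"
        proof (rule cINF_greatest[OF Q(1)])
          fix u assume "u \<in> Q"
          then have "u x \<le> u y + L * norm (x - y)" "(INF u\<in>Q. u x) \<le> u x"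
            using Q by (auto simp: S_def intro: cINF_lower[OF bdd])
          then show "(INF u\<in>Q. u x) - L * norm (x - y) \<le> u y" by linarith
        qed
        then show ?thesis by linarith
      qed
      ultimately show ?thesis by (simp add: S_def)
    qed
    show "T u \<in> S" if u: "u \<in> S" for u
    proof -
      note G = k G_cont[OF u] G_bnd[OF u] G_lip[OF u]
      have "T u x \<le> hi x" for x unfolding T_def
      proof (rule resolvent_le[OF G hi(1) bnd_ab[OF hi_ab] hi(2)])
        show "G u y \<le> k * hi y - F y (hi y)" for y
          using f_mono[of "u y" "hi y" y] S_ab[OF u] hi_ab S_hi[OF u, of y] unfolding G_def f_def by simp
      qed
      moreover have "lo x \<le> T u x" for x unfolding T_def
      proof (rule resolvent_ge[OF G lo(1) bnd_ab[OF lo_ab] lo(2)])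
        show "k * lo y - F y (lo y) \<le> G u y" for y
          using f_mono[of "lo y" "u y" y] S_ab[OF u] lo_ab S_lo[OF u, of y] unfolding G_def f_def by simp
      qed
      moreover have "T u x \<le> T u y + L * norm (x - y)" for x y
      proof -
        have "\<bar>T u x - T u y\<bar> \<le> K * B * norm (x - y)"
          unfolding T_def by (rule K_lip[OF G_cont[OF u] G_bnd[OF u]])
        also have "\<dots> \<le> L * norm (x - y)" by (intro mult_right_mono) (auto simp: L_def)
        finally show ?thesis by linarith
      qed
      ultimately show ?thesis by (simp add: S_def)
    qed
    show "T u \<le> T v" if u: "u \<in> S" and v: "v \<in> S" and le: "u \<le> v" for u v
    proof (rule le_funI, unfold T_def, rule resolvent_mono[OF k G_cont[OF u] G_bnd[OF u] G_cont[OF v] G_bnd[OF v]])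
      show "G u y \<le> G v y" for y
        using f_mono[of "u y" "v y" y] S_ab[OF u] S_ab[OF v] le_funD[OF le, of y] unfolding G_def by simp
    qed
  qed
  note G = G_cont[OF u(1)] G_bnd[OF u(1)]
  have u_eq: "resolvent k (G u) = u" using u(2) by (simp add: T_def)
  note lo_u = S_lo[OF u(1)] and u_hi = S_hi[OF u(1)]
  show ?thesis
  proof (rule that[of u])
    show "C_diff_on 2 UNIV u"
      using C_diff_on_resolvent[OF G G_lip[OF u(1)] k] by (simp add: u_eq)
    show "laplacian u x = F x (u x)" for x
      using laplacian_resolvent[OF G G_lip[OF u(1)] k, of x] by (simp add: u_eq) (simp add: G_def f_def)
    have ka: "\<bar>k * a\<bar> \<le> max B (k * max \<bar>a\<bar> \<bar>b\<bar>)" and kb: "\<bar>k * b\<bar> \<le> max B (k * max \<bar>a\<bar> \<bar>b\<bar>)"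
      using k by (auto simp: abs_mult le_max_iff_disj)
    have G': "\<bar>G u y\<bar> \<le> max B (k * max \<bar>a\<bar> \<bar>b\<bar>)" for y using G(2)[of y] by linarith
    \<comment> \<open>The slope of at least 1 turns the gap between \<open>u\<close> and
      \<open>a\<close> into a gap between the data whose resolvents are \<open>u\<close> and
      \<open>a\<close>.\<close>
    have ga: "G u y - k * a \<ge> u y - a" for y
      using f_mono[of a "u y" y] S_ab[OF u(1), of y] Fa[of y] ab by (simp add: G_def f_def)
    have gb: "k * b - G u y \<ge> b - u y" for y
      using f_mono[of "u y" b y] S_ab[OF u(1), of y] Fb[of y] ab by (simp add: G_def f_def)
    have const: "resolvent k (\<lambda>_::'a. k * c) x = c" for c x
      using resolvent_const[OF k, of "k * c" x] k by simp
    have ga': "k * a \<le> G u y" "k * a < G u y1" for y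
      using ga[of y] S_ab[OF u(1), of y] ga[of y1] lo_u[of y1] lo_ne by simp_all
    have gb': "G u y \<le> k * b" "G u y2 < k * b" for y
      using gb[of y] S_ab[OF u(1), of y] gb[of y2] u_hi[of y2] hi_ne by simp_all
    have "resolvent k (\<lambda>_. k * a) x < resolvent k (G u) x" for x
      by (rule resolvent_strict_mono[of k "\<lambda>_. k * a" _ "G u" y1, OF k continuous_on_const ka G(1) G' ga'])
    then show "a < u x" for x by (simp add: const u_eq)
    have "resolvent k (G u) x < resolvent k (\<lambda>_. k * b) x" for x
      by (rule resolvent_strict_mono[of k "G u" _ "\<lambda>_. k * b" y2, OF k G(1) G' continuous_on_const kb gb'])
    then show "u x < b" for x by (simp add: const u_eq)
    show "lo x \<le> u x" "u x \<le> hi x" for x by (rule lo_u u_hi)+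
  qed
qed

section \<open>The barrier in the plane\<close>

lemma C_diff_on_subset: "C_diff_on k T f \<Longrightarrow> S \<subseteq> T \<Longrightarrow> C_diff_on k S f"
  by (induction k arbitrary: f) (auto intro: continuous_on_subset)

lemma laplacian_le_mono: "laplacian_le v x c \<Longrightarrow> c \<le> d \<Longrightarrow> laplacian_le v x d"
  unfolding laplacian_le_def by (meson order_trans)

lemma laplacian_le_add_const: "laplacian_le v x c \<Longrightarrow> laplacian_le (\<lambda>y. d + v y) x c"
  unfolding laplacian_le_def by (simp add: algebra_simps)

lemma Basis_vec2: "(Basis :: (real^2) set) = {axis 1 1, axis 2 1}"
  by (auto simp: Basis_vec_def exhaust_2 UNIV_2)

definition reflect :: "real^2 \<Rightarrow> real^2" where
  "reflect x = (\<chi> i. if i = 1 then - x $ 1 else x $ i)"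

lemma reflect_nth [simp]: "reflect x $ 1 = - x $ 1" "reflect x $ 2 = x $ 2"
  by (simp_all add: reflect_def)

text \<open>Reflection exchanges the two points at distance \<open>s\<close> along the first axis,
  and the second difference is symmetric in them.\<close>

lemma laplacian_le_reflect:
  assumes "laplacian_le v (reflect x) c"
  shows "laplacian_le (\<lambda>y. v (reflect y)) x c"
proof -
  have 1: "reflect (x + s *\<^sub>R axis 1 1) = reflect x - s *\<^sub>R axis 1 1"
    "reflect (x - s *\<^sub>R axis 1 1) = reflect x + s *\<^sub>R axis 1 1"
    "reflect (x + s *\<^sub>R axis 2 1) = reflect x + s *\<^sub>R axis 2 1"
    "reflect (x - s *\<^sub>R axis 2 1) = reflect x - s *\<^sub>R axis 2 1" for s
    by (auto simp: vec_eq_iff forall_2 axis_def)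
  show ?thesis
    using assms unfolding laplacian_le_def by (simp add: Basis_vec2 1 algebra_simps)
qed

lemma laplacian_leI_2:
  fixes v :: "real^2 \<Rightarrow> real" and V :: "real \<Rightarrow> real \<Rightarrow> real"
  assumes le: "\<forall>\<^sub>F y in nhds x. v y \<le> V (y $ 1) (y $ 2)" and eq: "v x = V (x $ 1) (x $ 2)"
    and d1: "\<forall>\<^sub>F s in nhds (x $ 1). ((\<lambda>s. V s (x $ 2)) has_real_derivative V1 s) (at s)"
      "(V1 has_real_derivative v11) (at (x $ 1))"
    and d2: "\<forall>\<^sub>F t in nhds (x $ 2). ((\<lambda>t. V (x $ 1) t) has_real_derivative V2 t) (at t)"
      "(V2 has_real_derivative v22) (at (x $ 2))"
    and c: "v11 + v22 \<le> c"
  shows "laplacian_le v x c"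
proof (rule laplacian_leI[where \<phi> = "\<lambda>y. V (y $ 1) (y $ 2)"
      and \<phi>' = "\<lambda>e s. if e = axis 1 1 then V1 (x $ 1 + s) else V2 (x $ 2 + s)"
      and q = "\<lambda>e. if e = axis 1 1 then v11 else v22"])
  have ne: "axis 2 1 \<noteq> (axis 1 1 :: real^2)" by (simp add: axis_eq_axis)
  have shift: "((\<lambda>s. f (u + s)) has_real_derivative D) (at s)" if "(f has_real_derivative D) (at (u + s))" for f :: "real \<Rightarrow> real" and u s D
    using DERIV_shift[of f D s u] that by (simp add: add.commute)
  have ev: "\<forall>\<^sub>F s in nhds 0. P (u + s)" if "\<forall>\<^sub>F s in nhds u. P s" for P and u :: real
  proof -
    have "filterlim (\<lambda>s. u + s) (nhds u) (nhds 0)"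
      by (rule tendsto_eq_intros filterlim_ident refl | simp)+
    then show ?thesis using that by (simp add: filterlim_iff)
  qed
  show "\<forall>\<^sub>F s in nhds 0. ((\<lambda>s. V ((x + s *\<^sub>R e) $ 1) ((x + s *\<^sub>R e) $ 2)) has_real_derivative
      (if e = axis 1 1 then V1 (x $ 1 + s) else V2 (x $ 2 + s))) (at s)" if "e \<in> Basis" for e
  proof -
    consider "e = axis 1 1" | "e = axis 2 1" using \<open>e \<in> Basis\<close> by (auto simp: Basis_vec2)
    then show ?thesis
    proof cases
      case 1
      show ?thesis using ev[OF d1(1)] by (auto simp: 1 axis_def intro: shift elim!: eventually_mono)
    next
      case 2
      show ?thesis using ev[OF d2(1)] ne by (auto simp: 2 axis_def intro: shift elim!: eventually_mono)
    qed
  qed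
  show "((\<lambda>s. if e = axis 1 1 then V1 (x $ 1 + s) else V2 (x $ 2 + s)) has_real_derivative (if e = axis 1 1 then v11 else v22)) (at 0)"
    if "e \<in> Basis" for e
    using d1(2) d2(2) by (auto intro!: shift)
  show "(\<Sum>e\<in>(Basis :: (real^2) set). if e = axis 1 1 then v11 else v22) \<le> c"
    using c ne by (simp add: Basis_vec2 eq_commute)
qed (use le eq in auto)

text \<open>The chain rule for a function homogeneous of degree - \<sigma>, written in the slope
  \<tau>. In the bracket, \<open>q''\<close> with coefficient 1 comes from the second variable and
  everything else from the first.\<close>

lemma homogeneous_laplacian_le:
  fixes v :: "real^2 \<Rightarrow> real" and q q' q'' :: "real \<Rightarrow> real"
  assumes q: "\<And>t. (q has_real_derivative q' t) (at t)" "\<And>t. (q' has_real_derivative q'' t) (at t)"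
    and x: "x $ 1 > 0"
    and le: "\<forall>\<^sub>F y in nhds x. v y \<le> (y $ 1) powr (- \<sigma>) * q (y $ 2 / y $ 1)"
    and eq: "v x = (x $ 1) powr (- \<sigma>) * q (x $ 2 / x $ 1)"
    and \<tau>: "\<tau> = x $ 2 / x $ 1"
  shows "laplacian_le v x ((x $ 1) powr (- \<sigma> - 2) *
    (\<sigma> * (\<sigma> + 1) * q \<tau> + (2 * \<sigma> + 2) * (\<tau> * q' \<tau>) + (1 + \<tau>\<^sup>2) * q'' \<tau>))"
proof (rule laplacian_leI_2[where V = "\<lambda>s t. s powr (- \<sigma>) * q (t / s)"
    and ?V1.0 = "\<lambda>s. s powr (- \<sigma> - 1) * (- \<sigma> * q (x $ 2 / s) - (x $ 2 / s) * q' (x $ 2 / s))"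
    and ?V2.0 = "\<lambda>t. (x $ 1) powr (- \<sigma> - 1) * q' (t / x $ 1)"
    and ?v11.0 = "(x $ 1) powr (- \<sigma> - 2) * (\<sigma> * (\<sigma> + 1) * q \<tau> + (2 * \<sigma> + 2) * (\<tau> * q' \<tau>) + \<tau>\<^sup>2 * q'' \<tau>)"
    and ?v22.0 = "(x $ 1) powr (- \<sigma> - 2) * q'' \<tau>", OF le eq])
  have p1: "s powr (- \<sigma> - 1) = s powr (- \<sigma>) / s" "s powr (- \<sigma> - 2) = s powr (- \<sigma>) / s\<^sup>2"
    "s powr (- \<sigma> - 1 - 1) = s powr (- \<sigma>) / s\<^sup>2" if "s > 0" for s
    using that powr_diff[of s "- \<sigma>" 1] powr_diff[of s "- \<sigma>" 2] powr_diff[of s "- \<sigma> - 1" 1]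
    by (simp_all add: powr_numeral power2_eq_square)
  have chain: "((\<lambda>s. f (x $ 2 / s)) has_real_derivative f' (x $ 2 / s) * (- (x $ 2 / s\<^sup>2))) (at s)"
    if "\<And>t. (f has_real_derivative f' t) (at t)" "s > 0" for f f' s
    by (rule DERIV_chain2[OF that(1)]) (use that(2) in \<open>auto intro!: derivative_eq_intros simp: power2_eq_square\<close>)
  have chain2: "((\<lambda>t. f (t / x $ 1)) has_real_derivative f' (t / x $ 1) * (1 / x $ 1)) (at t)"
    if "\<And>t. (f has_real_derivative f' t) (at t)" for f f' t
    by (rule DERIV_chain2[OF that(1)]) (use x in \<open>auto intro!: derivative_eq_intros\<close>)
  have "\<forall>\<^sub>F s in nhds (x $ 1). s > 0"
    using x eventually_nhds_in_open[of "{0<..}" "x $ 1"] by auto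
  then show "\<forall>\<^sub>F s in nhds (x $ 1). ((\<lambda>s. s powr (- \<sigma>) * q (x $ 2 / s)) has_real_derivative
      s powr (- \<sigma> - 1) * (- \<sigma> * q (x $ 2 / s) - (x $ 2 / s) * q' (x $ 2 / s))) (at s)"
  proof eventually_elim
    case (elim s)
    show ?case
      by (rule DERIV_cong[OF DERIV_mult[OF has_real_derivative_powr[OF elim] chain[OF q(1) elim]]])
        (use elim in \<open>simp add: p1 field_simps power2_eq_square\<close>)
  qed
  have i: "((\<lambda>s. x $ 2 / s) has_real_derivative - (x $ 2 / (x $ 1)\<^sup>2)) (at (x $ 1))"
    using x by (auto intro!: derivative_eq_intros simp: power2_eq_square)
  show "((\<lambda>s. s powr (- \<sigma> - 1) * (- \<sigma> * q (x $ 2 / s) - (x $ 2 / s) * q' (x $ 2 / s))) has_real_derivative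
      (x $ 1) powr (- \<sigma> - 2) * (\<sigma> * (\<sigma> + 1) * q \<tau> + (2 * \<sigma> + 2) * (\<tau> * q' \<tau>) + \<tau>\<^sup>2 * q'' \<tau>)) (at (x $ 1))"
    unfolding \<tau>
    by (rule DERIV_cong[OF DERIV_mult[OF has_real_derivative_powr[OF x]
          DERIV_diff[OF DERIV_cmult[OF chain[OF q(1) x]] DERIV_mult[OF i chain[OF q(2) x]]]]])
      (use x in \<open>simp add: p1 field_simps power2_eq_square\<close>)
  show "\<forall>\<^sub>F t in nhds (x $ 2). ((\<lambda>t. (x $ 1) powr (- \<sigma>) * q (t / x $ 1)) has_real_derivative
      (x $ 1) powr (- \<sigma> - 1) * q' (t / x $ 1)) (at t)"
    using x by (intro always_eventually allI DERIV_cong[OF DERIV_cmult[OF chain2[OF q(1)]]]) (simp add: p1)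
  show "((\<lambda>t. (x $ 1) powr (- \<sigma> - 1) * q' (t / x $ 1)) has_real_derivative (x $ 1) powr (- \<sigma> - 2) * q'' \<tau>) (at (x $ 2))"
    unfolding \<tau> using x by (intro DERIV_cong[OF DERIV_cmult[OF chain2[OF q(2)]]]) (simp add: p1 power2_eq_square)
qed (simp add: algebra_simps)

text \<open>The bracket of \<open>homogeneous_laplacian_le\<close> has a first term of at most
  \<open>2 * \<sigma> * (\<sigma> + 1)\<close>, a second term that is nonpositive, and a third that
  is at most \<open>- \<beta> / 2\<close> in the cone and at most \<open>8 * \<beta>\<close>
  anywhere. The first bound on the third term gives the nonlinear estimate, the second the linear
  one.\<close>

lemma barrier:
  fixes p c m :: real
  assumes p: "p > 1" and c: "c > 0" and m: "m > 0"
  obtains v :: "real^2 \<Rightarrow> real" and X0 l' C1 where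
    "X0 > 0" "l' > 0" "C1 \<ge> 0" "continuous_on UNIV v" "\<And>x. 0 < v x" "\<And>x. v x \<le> m"
    "\<And>x. x $ 1 \<le> X0 \<Longrightarrow> v x = m"
    "\<And>\<eta>. \<eta> > 0 \<Longrightarrow> \<exists>M. \<forall>x. x $ 1 > M \<longrightarrow> v x < \<eta>"
    "\<And>x. v x < m \<Longrightarrow> \<exists>d. laplacian_le v x d \<and> d \<le> C1 * v x \<and> (\<bar>x $ 2\<bar> \<le> l' * x $ 1 \<longrightarrow> d \<le> - c * v x powr p)"
proof -
  \<comment> \<open>chosen so that \<open>\<sigma> p = \<sigma> + 2\<close>\<close>
  define \<sigma> where "\<sigma> = 2 / (p - 1)"
  have \<sigma>: "\<sigma> > 0" using p by (simp add: \<sigma>_def)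
  have \<sigma>p: "\<sigma> * p = \<sigma> + 2" using p by (simp add: \<sigma>_def field_simps)
  \<comment> \<open>Half of \<beta> has to cover \<open>2 * \<sigma> * (\<sigma> + 1)\<close>, which
    bounds the terms without \<open>q''\<close>, plus \<open>c * 2 powr p\<close>, which comes from
    \<open>v \<le> 2 * x1 powr (- \<sigma>)\<close>.\<close>
  define \<beta> where "\<beta> = max 1 (4 * \<sigma> * (\<sigma> + 1) + 2 * c * 2 powr p)"
  have \<beta>: "\<beta> \<ge> 1" "\<beta> / 2 \<ge> 2 * \<sigma> * (\<sigma> + 1) + c * 2 powr p" by (auto simp: \<beta>_def)
  \<comment> \<open>The profile stays between 1 and 2, so \<open>V\<close> is comparable to
    \<open>x1 powr (- \<sigma>)\<close> at every slope, while it is strongly concave near slope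
    0.\<close>
  define q where "q t = 1 + 1 / (1 + \<beta> * t\<^sup>2)" for t
  define q' where "q' t = - 2 * \<beta> * t / (1 + \<beta> * t\<^sup>2)\<^sup>2" for t
  define q'' where "q'' t = \<beta> * (6 * \<beta> * t\<^sup>2 - 2) / (1 + \<beta> * t\<^sup>2) ^ 3" for t
  have D: "1 + \<beta> * t\<^sup>2 > 0" for t using \<beta>(1) by (intro add_pos_nonneg) auto
  have q1: "(q has_real_derivative q' t) (at t)" for t
    unfolding q_def q'_def using D[of t]
    by (auto intro!: derivative_eq_intros simp: power2_eq_square)
  have q2: "(q' has_real_derivative q'' t) (at t)" for t
  proof -
    define d where "d = 1 + \<beta> * t\<^sup>2"
    have d: "d > 0" using D by (simp add: d_def)
    have num: "((\<lambda>t. - 2 * \<beta> * t) has_real_derivative - 2 * \<beta>) (at t)"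
      by (auto intro!: derivative_eq_intros)
    have den: "((\<lambda>t. (1 + \<beta> * t\<^sup>2)\<^sup>2) has_real_derivative 2 * d * (2 * \<beta> * t)) (at t)"
      by (auto intro!: derivative_eq_intros simp: d_def)
    have "(q' has_real_derivative ((- 2 * \<beta>) * d\<^sup>2 - (- 2 * \<beta> * t) * (2 * d * (2 * \<beta> * t))) / (d\<^sup>2 * d\<^sup>2)) (at t)"
      unfolding q'_def using DERIV_divide[OF num den] d by (simp add: d_def)
    also have "(- 2 * \<beta>) * d\<^sup>2 - (- 2 * \<beta> * t) * (2 * d * (2 * \<beta> * t)) = d * (\<beta> * (8 * \<beta> * t\<^sup>2 - 2 * d))"
      by (simp add: power2_eq_square algebra_simps)
    also have "\<beta> * (8 * \<beta> * t\<^sup>2 - 2 * d) = \<beta> * (6 * \<beta> * t\<^sup>2 - 2)" by (simp add: d_def)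
    also have "d * (\<beta> * (6 * \<beta> * t\<^sup>2 - 2)) / (d\<^sup>2 * d\<^sup>2) = q'' t"
      unfolding q''_def d_def[symmetric] using d by (simp add: power2_eq_square power3_eq_cube)
    finally show ?thesis .
  qed
  have q_ge: "q t > 1" and q_le: "q t \<le> 2" for t
    using D[of t] \<beta>(1) by (auto simp: q_def divide_le_eq_1)
  have tq': "t * q' t \<le> 0" for t
  proof -
    have "t * q' t = - (2 * \<beta> * t\<^sup>2 / (1 + \<beta> * t\<^sup>2)\<^sup>2)" by (simp add: q'_def power2_eq_square)
    then show ?thesis using \<beta>(1) by simp
  qed
  have q''_le: "(1 + t\<^sup>2) * q'' t \<le> 8 * \<beta>" for t
  proof -
    define d where "d = 1 + \<beta> * t\<^sup>2"
    have d1: "d \<ge> 1" using \<beta>(1) by (simp add: d_def)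
    have "1 * t\<^sup>2 \<le> \<beta> * t\<^sup>2" using \<beta>(1) by (intro mult_right_mono) auto
    then have td: "1 + t\<^sup>2 \<le> d" by (simp add: d_def)
    have "(1 + t\<^sup>2) * (6 * \<beta> * t\<^sup>2 - 2) \<le> (1 + t\<^sup>2) * (6 * d)"
      by (intro mult_left_mono) (auto simp: d_def)
    also have "\<dots> \<le> d * (6 * d)" using td d1 by (intro mult_right_mono) auto
    also have "\<dots> \<le> 8 * d ^ 3"
    proof -
      have "d * d * 1 \<le> d * d * d" using d1 by (intro mult_left_mono) auto
      moreover have "0 \<le> d * d" by simp
      ultimately show ?thesis unfolding power3_eq_cube by linarith
    qed
    finally have "\<beta> * ((1 + t\<^sup>2) * (6 * \<beta> * t\<^sup>2 - 2)) \<le> \<beta> * (8 * d ^ 3)" using \<beta>(1) by (intro mult_left_mono) auto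
    then show ?thesis using d1 by (simp add: q''_def d_def[symmetric] divide_le_eq mult_ac)
  qed
  \<comment> \<open>In this range the numerator factor \<open>6 * \<beta> * t\<^sup>2 - 2\<close> is
    at most -1 and the denominator at most \<open>(7/6)^3 < 2\<close>.\<close>
  have q''_neg: "(1 + t\<^sup>2) * q'' t \<le> - \<beta> / 2" if t: "6 * \<beta> * t\<^sup>2 \<le> 1" for t
  proof -
    define d where "d = 1 + \<beta> * t\<^sup>2"
    have d: "1 \<le> d" "d \<le> 7 / 6" using \<beta>(1) t by (auto simp: d_def)
    have "d ^ 3 \<le> (7 / 6) ^ 3" using d by (intro power_mono) auto
    then have d3: "0 < d ^ 3" "d ^ 3 \<le> 2" using d by (auto simp: power3_eq_cube)
    have "\<beta> / 2 \<le> \<beta> / d ^ 3" using d3 \<beta>(1) by (intro divide_left_mono) auto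
    moreover have "q'' t \<le> \<beta> * (- 1) / d ^ 3"
      unfolding q''_def d_def[symmetric] using t \<beta>(1) d3 by (intro divide_right_mono mult_left_mono) auto
    moreover have "\<beta> * (- 1) / d ^ 3 = - (\<beta> / d ^ 3)" by simp
    ultimately have q: "q'' t \<le> - \<beta> / 2" by linarith
    have "(1 + t\<^sup>2) * q'' t = q'' t + t\<^sup>2 * q'' t" by (simp add: algebra_simps)
    moreover have "t\<^sup>2 * q'' t \<le> 0" using q \<beta>(1) by (intro mult_nonneg_nonpos) auto
    ultimately show ?thesis using q by linarith
  qed
  \<comment> \<open>Solves \<open>X0 powr (- \<sigma>) = m\<close>. As \<open>q > 1\<close>, the
    function \<open>V\<close> is already above the cap \<open>m\<close> on the line
    \<open>x1 = X0\<close>.\<close>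
  define X0 where "X0 = m powr (- 1 / \<sigma>)"
  have X0: "X0 > 0" using m by (simp add: X0_def)
  have X0m: "X0 powr (- \<sigma>) = m" using m \<sigma> by (simp add: X0_def powr_powr)
  define V where "V s t = s powr (- \<sigma>) * q (t / s)" for s t
  \<comment> \<open>Freezing the first argument at \<open>X0\<close> keeps the power away from its
    singularity and makes the cap active on the whole half plane \<open>x1 \<le> X0\<close>, so
    \<open>v\<close> is continuous there.\<close>
  define v where "v x = min m (V (max (x $ 1) X0) (x $ 2))" for x :: "real^2"
  \<comment> \<open>The slope with \<open>6 * \<beta> * l'\<^sup>2 = 1\<close>, up to which the
    estimate \<open>q''_neg\<close> holds.\<close>
  define l' where "l' = sqrt (1 / (6 * \<beta>))"
  define C1 where "C1 = (2 * \<sigma> * (\<sigma> + 1) + 8 * \<beta>) / X0\<^sup>2"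
  have V_pos: "V s t > 0" if "s > 0" for s t using that q_ge[of "t / s"] by (simp add: V_def)
  have V_le: "V s t \<le> 2 * s powr (- \<sigma>)" for s t
    using mult_left_mono[OF q_le[of "t / s"], of "s powr (- \<sigma>)"] by (simp add: V_def mult.commute)
  have V_ge: "V s t \<ge> s powr (- \<sigma>)" for s t
    using mult_left_mono[OF less_imp_le[OF q_ge[of "t / s"]], of "s powr (- \<sigma>)"] by (simp add: V_def)
  have v_m: "v x = m" if "x $ 1 \<le> X0" for x
    using that V_ge[of X0 "x $ 2"] by (simp add: v_def max_def X0m)
  show ?thesis
  proof (rule that[of X0 l' C1 v])
    show "X0 > 0" by (rule X0)
    show "l' > 0" "C1 \<ge> 0" using \<beta>(1) \<sigma> by (auto simp: l'_def C1_def)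
    have q_cont: "continuous_on UNIV q"
      using q1 by (auto intro: DERIV_isCont simp: continuous_on_eq_continuous_at)
    have mx: "max s X0 \<noteq> 0" for s using X0 by (auto simp: max_def)
    show "continuous_on UNIV v"
      unfolding v_def V_def
      by (intro continuous_intros continuous_on_compose2[OF q_cont]) (use mx X0 in \<open>auto simp: le_max_iff_disj\<close>)
    show "0 < v x" for x using m V_pos[of "max (x $ 1) X0" "x $ 2"] X0 by (auto simp: v_def less_max_iff_disj)
    show "v x \<le> m" for x by (simp add: v_def)
    show "x $ 1 \<le> X0 \<Longrightarrow> v x = m" for x by (rule v_m)
    show "\<exists>M. \<forall>x. x $ 1 > M \<longrightarrow> v x < \<eta>" if \<eta>: "\<eta> > 0" for \<eta>
    proof -
      have "((\<lambda>s::real. 2 * s powr (- \<sigma>)) \<longlongrightarrow> 2 * 0) at_top"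
        using \<sigma> by (intro tendsto_intros tendsto_neg_powr filterlim_ident) auto
      then have "\<forall>\<^sub>F s in at_top. 2 * s powr (- \<sigma>) < \<eta>" using order_tendstoD(2) \<eta> by auto
      then obtain M where M: "\<And>s. s \<ge> M \<Longrightarrow> 2 * s powr (- \<sigma>) < \<eta>"
        unfolding eventually_at_top_linorder by blast
      have "v x < \<eta>" if "x $ 1 > max M X0" for x
      proof -
        have "max (x $ 1) X0 = x $ 1" using that by (simp add: max_absorb1)
        then have "v x \<le> V (x $ 1) (x $ 2)" by (simp add: v_def)
        also have "\<dots> < \<eta>" using V_le[of "x $ 1" "x $ 2"] M[of "x $ 1"] that by simp
        finally show ?thesis .
      qed
      then show ?thesis by blast
    qed
    show "\<exists>d. laplacian_le v x d \<and> d \<le> C1 * v x \<and> (\<bar>x $ 2\<bar> \<le> l' * x $ 1 \<longrightarrow> d \<le> - c * v x powr p)"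
      if "v x < m" for x
    proof -
      have x1: "x $ 1 > X0" using v_m[of x] that by (cases "x $ 1 \<le> X0") simp_all
      then have x0: "x $ 1 > 0" using X0 by simp
      define \<tau> where "\<tau> = x $ 2 / x $ 1"
      define P where "P = (x $ 1) powr (- \<sigma> - 2)"
      have P: "P \<ge> 0" by (simp add: P_def)
      have vx: "v x = V (x $ 1) (x $ 2)" using that x1 by (auto simp: v_def max_def min_def split: if_splits)
      let ?E = "\<sigma> * (\<sigma> + 1) * q \<tau> + (2 * \<sigma> + 2) * (\<tau> * q' \<tau>) + (1 + \<tau>\<^sup>2) * q'' \<tau>"
      have "open {y :: real^2. y $ 1 > X0}"
        by (rule open_Collect_less) (auto intro!: continuous_intros)
      then have "\<forall>\<^sub>F y in nhds x. y \<in> {y. y $ 1 > X0}"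
        using x1 by (intro eventually_nhds_in_open) auto
      then have ev: "\<forall>\<^sub>F y in nhds x. v y \<le> (y $ 1) powr (- \<sigma>) * q (y $ 2 / y $ 1)"
        by eventually_elim (simp add: v_def V_def max_def)
      have lap: "laplacian_le v x (P * ?E)"
        unfolding P_def
        by (rule homogeneous_laplacian_le[OF q1 q2 x0 ev]) (simp_all add: vx V_def \<tau>_def)
      have E1: "\<sigma> * (\<sigma> + 1) * q \<tau> + (2 * \<sigma> + 2) * (\<tau> * q' \<tau>) \<le> 2 * \<sigma> * (\<sigma> + 1)"
      proof -
        have "\<sigma> * (\<sigma> + 1) * q \<tau> \<le> \<sigma> * (\<sigma> + 1) * 2" using q_le \<sigma> by (intro mult_left_mono) auto
        moreover have "(2 * \<sigma> + 2) * (\<tau> * q' \<tau>) \<le> 0" using \<sigma> by (intro mult_nonneg_nonpos[OF _ tq']) simp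
        ultimately show ?thesis by linarith
      qed
      have "P * ?E \<le> C1 * v x"
      proof -
        \<comment> \<open>Off the cone the extra decay \<open>x1 powr (- 2)\<close> is traded for
          the constant \<open>1 / X0\<^sup>2\<close>; the outcome is linear in \<open>v\<close>, so
          a bounded zeroth-order coefficient can absorb it.\<close>
        have "P = (x $ 1) powr (- \<sigma>) / (x $ 1)\<^sup>2"
          using x0 by (simp add: P_def powr_diff powr_numeral)
        also have "\<dots> \<le> v x / X0\<^sup>2"
          using V_ge[of "x $ 1" "x $ 2"] X0 x1 V_pos[OF x0, of "x $ 2"] unfolding vx by (intro frac_le power_mono) auto
        finally have Pv: "P \<le> v x / X0\<^sup>2" .
        have "P * ?E \<le> P * (2 * \<sigma> * (\<sigma> + 1) + 8 * \<beta>)"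
          using E1 q''_le[of \<tau>] P by (intro mult_left_mono) auto
        also have "\<dots> \<le> v x / X0\<^sup>2 * (2 * \<sigma> * (\<sigma> + 1) + 8 * \<beta>)"
          using Pv \<sigma> \<beta>(1) by (intro mult_right_mono) auto
        finally have "P * ?E \<le> v x / X0\<^sup>2 * (2 * \<sigma> * (\<sigma> + 1) + 8 * \<beta>)" .
        then show ?thesis by (simp add: C1_def mult_ac)
      qed
      moreover have "P * ?E \<le> - c * v x powr p" if cone: "\<bar>x $ 2\<bar> \<le> l' * x $ 1"
      proof -
        have "\<bar>\<tau>\<bar> \<le> l'" using cone x0 by (simp add: \<tau>_def abs_divide divide_le_eq)
        then have "\<tau>\<^sup>2 \<le> l'\<^sup>2" using power_mono[of "\<bar>\<tau>\<bar>" l' 2] by simp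
        also have "l'\<^sup>2 = 1 / (6 * \<beta>)" using \<beta>(1) by (simp add: l'_def)
        finally have "6 * \<beta> * \<tau>\<^sup>2 \<le> 1" using \<beta>(1) by (simp add: le_divide_eq mult_ac)
        then have "?E \<le> - (c * 2 powr p)" using E1 q''_neg[of \<tau>] \<beta>(2) by simp
        then have "P * ?E \<le> P * (- (c * 2 powr p))" using P by (rule mult_left_mono)
        moreover have "v x powr p \<le> 2 powr p * P"
        proof -
          have "v x powr p \<le> (2 * (x $ 1) powr (- \<sigma>)) powr p"
            using V_le[of "x $ 1" "x $ 2"] V_pos[OF x0, of "x $ 2"] p unfolding vx by (intro powr_mono2) auto
          \<comment> \<open>Here the exponents meet:
            \<open>\<sigma> * p = \<sigma> + 2\<close>.\<close>
          also have "\<dots> = 2 powr p * P"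
            using \<sigma>p by (simp add: powr_mult powr_powr P_def)
          finally show ?thesis .
        qed
        then have "c * v x powr p \<le> c * (2 powr p * P)" using c by (intro mult_left_mono) auto
        ultimately show ?thesis by (simp add: mult_ac)
      qed
      ultimately show ?thesis using lap by blast
    qed
  qed
qed

lemma abs_clamp_diff_le: "\<bar>max 0 (min 1 s) - max 0 (min 1 t)\<bar> \<le> \<bar>s - t :: real\<bar>"
  by (auto simp: max_def min_def)

lemma abs_min_diff_le: "\<bar>min a b - min c d\<bar> \<le> \<bar>a - c\<bar> + \<bar>b - d :: real\<bar>"
  by (auto simp: min_def)

theorem proposition2p6:
  fixes p a b c :: real and W :: "real \<Rightarrow> real"
  assumes "p > 1" and "a < b" and "c > 0"
    and "C11_loc W"
    and "deriv W a = 0" and "deriv W b = 0"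
    and "\<forall>s\<in>{a<..<b}. deriv W s < 0"
    and "\<forall>s\<in>{a..b}. deriv W s \<ge> - c * (s - a) powr p"
  shows "\<exists>l0>0. \<exists>\<epsilon>0>0. \<forall>l\<in>{0<..<l0}. \<forall>\<epsilon>\<in>{0<..<\<epsilon>0}. \<forall>\<psi> :: real \<Rightarrow> real.
    C_infinity_on UNIV \<psi> \<and> (\<forall>s. \<psi> s > 0) \<and> (\<forall>s. \<bar>s\<bar> > \<epsilon> \<longrightarrow> \<psi> s = l * \<bar>s\<bar>) \<longrightarrow>
    (\<exists>u :: real ^ 2 \<Rightarrow> real.
       C_diff_on 2 (profile_domain \<psi>) u \<and>
       (\<forall>x\<in>profile_domain \<psi>. laplacian u x = deriv W (u x)) \<and>
       u ` profile_domain \<psi> \<subseteq> {a<..<b} \<and>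
       (\<forall>\<eta>>0. \<exists>M. \<forall>x\<in>profile_domain \<psi>. x $ 1 > M \<longrightarrow> \<bar>u x - a\<bar> < \<eta>) \<and>
       (\<forall>\<eta>>0. \<exists>M. \<forall>x\<in>profile_domain \<psi>. x $ 1 < M \<longrightarrow> \<bar>u x - b\<bar> < \<eta>))"
proof -
  define m where "m = b - a"
  have m: "m > 0" using \<open>a < b\<close> by (simp add: m_def)
  obtain v :: "real^2 \<Rightarrow> real" and X0 l' C1 where X0: "X0 > 0" and l': "l' > 0" and C1: "C1 \<ge> 0"
    and v_cont: "continuous_on UNIV v" and v_pos: "\<And>x. 0 < v x" and v_le: "\<And>x. v x \<le> m"
    and v_m: "\<And>x. x $ 1 \<le> X0 \<Longrightarrow> v x = m"
    and v_lim: "\<And>\<eta>. \<eta> > 0 \<Longrightarrow> \<exists>M. \<forall>x. x $ 1 > M \<longrightarrow> v x < \<eta>"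
    and v_lap: "\<And>x. v x < m \<Longrightarrow> \<exists>d. laplacian_le v x d \<and> d \<le> C1 * v x \<and>
      (\<bar>x $ 2\<bar> \<le> l' * x $ 1 \<longrightarrow> d \<le> - c * v x powr p)"
    using barrier[OF \<open>p > 1\<close> \<open>c > 0\<close> m] by metis
  obtain L where L: "L \<ge> 0" "\<And>s t. s \<in> {a..b} \<Longrightarrow> t \<in> {a..b} \<Longrightarrow> \<bar>deriv W s - deriv W t\<bar> \<le> L * \<bar>s - t\<bar>"
    using \<open>C11_loc W\<close> compact_Icc[of a b] unfolding C11_loc_def lipschitz_on_def dist_real_def by metis
  have W'_neg: "deriv W s \<le> 0" if "s \<in> {a..b}" for s
    using that assms(5,6,7) by (cases "s = a"; cases "s = b") (auto intro: less_imp_le)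
  have W'_La: "deriv W s \<ge> - L * (s - a)" if "s \<in> {a..b}" for s
    using L(2)[OF that, of a] that \<open>deriv W a = 0\<close> \<open>a < b\<close> by auto
  show ?thesis
  \<comment> \<open>Both thresholds come from the barrier: its cone slope and the abscissa up to
    which it is capped.\<close>
  proof (rule exI[of _ l'], intro conjI l', rule exI[of _ X0], intro conjI X0 ballI allI impI)
    fix l \<epsilon> \<psi>
    assume l: "l \<in> {0<..<l'}" and \<epsilon>: "\<epsilon> \<in> {0<..<X0}"
      and \<psi>: "C_infinity_on UNIV \<psi> \<and> (\<forall>s. \<psi> s > 0) \<and> (\<forall>s. \<bar>s\<bar> > \<epsilon> \<longrightarrow> \<psi> s = l * \<bar>s\<bar>)"

    \<comment> \<open>A cut-off that vanishes on the domain and is full outside the wider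
      cone\<close>
    define \<alpha> where "\<alpha> = 1 / (X0 - \<epsilon>)"
    \<comment> \<open>The ramps rise from 0 to 1 between \<epsilon> and \<open>X0\<close>, and
      between slopes \<open>l\<close> and \<open>l'\<close>; \<open>(l' - l) * X0\<close> is the
      least vertical gap between these slopes for \<open>s \<ge> X0\<close>.\<close>
    define \<gamma> where "\<gamma> = 1 / ((l' - l) * X0)"
    \<comment> \<open>The height has two parts: \<open>C1\<close> outweighs the Laplacian of the
      barrier off the cone, and \<open>L\<close> outweighs \<open>W'\<close>, which is at least
      \<open>- L * (s - a)\<close>.\<close>
    define A where "A s t = (C1 + L) * max 0 (min 1 (min (\<alpha> * (s - \<epsilon>)) (\<gamma> * (\<bar>t\<bar> - l * s))))" for s t
    have \<alpha>: "\<alpha> > 0" and \<gamma>: "\<gamma> > 0" using l \<epsilon> X0 by (auto simp: \<alpha>_def \<gamma>_def)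
    have A_nonneg: "0 \<le> A s t" and A_le: "A s t \<le> C1 + L" for s t
      using C1 L(1) by (auto simp: A_def intro!: mult_left_le)
    have A_0: "A s t = 0" if "s \<le> \<epsilon> \<or> \<bar>t\<bar> \<le> l * s" for s t
    proof -
      have "\<alpha> * (s - \<epsilon>) \<le> 0 \<or> \<gamma> * (\<bar>t\<bar> - l * s) \<le> 0"
        using that \<alpha> \<gamma> by (auto simp: mult_le_0_iff)
      then show ?thesis by (auto simp: A_def)
    qed
    have A_1: "A s t = C1 + L" if "s \<ge> X0" "\<bar>t\<bar> \<ge> l' * s" for s t
    proof -
      have "\<alpha> * (s - \<epsilon>) \<ge> 1" using that \<epsilon> by (simp add: \<alpha>_def le_divide_eq)
      moreover have "(l' - l) * X0 \<le> \<bar>t\<bar> - l * s"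
      proof -
        have "(l' - l) * X0 \<le> (l' - l) * s" using that l by (intro mult_left_mono) auto
        also have "\<dots> \<le> \<bar>t\<bar> - l * s" using that by (simp add: left_diff_distrib)
        finally show ?thesis .
      qed
      then have "\<gamma> * (\<bar>t\<bar> - l * s) \<ge> 1" using l X0 by (simp add: \<gamma>_def le_divide_eq)
      ultimately show ?thesis by (simp add: A_def)
    qed
    define K where "K = (C1 + L) * (\<alpha> + \<gamma> * (1 + l))"
    have K: "K \<ge> 0" using C1 L(1) \<alpha> \<gamma> l by (simp add: K_def)
    have A_lip: "\<bar>A s t - A s' t'\<bar> \<le> K * r" if "\<bar>s - s'\<bar> \<le> r" "\<bar>t - t'\<bar> \<le> r" for s t s' t' r
    proof -
      have "\<bar>A s t - A s' t'\<bar> = (C1 + L) * \<bar>max 0 (min 1 (min (\<alpha> * (s - \<epsilon>)) (\<gamma> * (\<bar>t\<bar> - l * s))))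
          - max 0 (min 1 (min (\<alpha> * (s' - \<epsilon>)) (\<gamma> * (\<bar>t'\<bar> - l * s'))))\<bar>"
        using C1 L(1) unfolding A_def right_diff_distrib[symmetric] abs_mult by simp
      also have "\<dots> \<le> (C1 + L) * (\<bar>\<alpha> * (s - \<epsilon>) - \<alpha> * (s' - \<epsilon>)\<bar> + \<bar>\<gamma> * (\<bar>t\<bar> - l * s) - \<gamma> * (\<bar>t'\<bar> - l * s')\<bar>)"
        using C1 L(1) by (intro mult_left_mono order_trans[OF abs_clamp_diff_le abs_min_diff_le]) auto
      also have "\<dots> \<le> (C1 + L) * (\<alpha> * r + \<gamma> * ((1 + l) * r))"
      proof (intro mult_left_mono add_mono)
        show "\<bar>\<alpha> * (s - \<epsilon>) - \<alpha> * (s' - \<epsilon>)\<bar> \<le> \<alpha> * r"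
          using that \<alpha> by (simp add: right_diff_distrib[symmetric] abs_mult)
        have "\<bar>l * (s - s')\<bar> \<le> l * r" using that l by (simp add: abs_mult)
        then have "\<bar>(\<bar>t\<bar> - l * s) - (\<bar>t'\<bar> - l * s')\<bar> \<le> (1 + l) * r"
          using that by (simp add: algebra_simps)
        then show "\<bar>\<gamma> * (\<bar>t\<bar> - l * s) - \<gamma> * (\<bar>t'\<bar> - l * s')\<bar> \<le> \<gamma> * ((1 + l) * r)"
          using \<gamma> by (simp add: right_diff_distrib[symmetric] abs_mult)
      qed (use C1 L(1) in auto)
      also have "\<dots> = K * r" by (simp add: K_def algebra_simps)
      finally show ?thesis .
    qed
    \<comment> \<open>The factors \<open>s - a\<close> and \<open>b - s\<close> make each correction
      vanish at the end value towards which it pushes, which yields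
      \<open>F x a \<le> 0 \<le> F x b\<close>.\<close>
    define F where "F x s = deriv W s + A (x $ 1) (x $ 2) * (s - a) - A (- x $ 1) (x $ 2) * (b - s)" for x :: "real^2" and s
    define lo where "lo x = b - v (reflect x)" for x
    define hi where "hi x = a + v x" for x
    \<comment> \<open>A ramp from \<open>b\<close> at \<open>x1 \<le> - X0\<close> to
      \<open>a\<close> at \<open>x1 \<ge> 0\<close>: it leaves \<open>a\<close> only where the upper
      barrier is \<open>b\<close>, and is strictly below \<open>b\<close> only where the lower
      barrier is \<open>a\<close>.\<close>
    define w0 where "w0 x = a + m * max 0 (min 1 (- x $ 1 / X0))" for x :: "real^2"

    \<comment> \<open>Super- and subsolution of the extended equation\<close>
    have lap: "v x = m \<or> (\<exists>d. x $ 1 > X0 \<and> laplacian_le v x d \<and> d \<le> deriv W (a + v x) + A (x $ 1) (x $ 2) * v x)" for x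
    proof (cases "v x = m")
      case False
      then have vm: "v x < m" using v_le[of x] by simp
      then have x1: "x $ 1 > X0" using v_m[of x] by (cases "x $ 1 \<le> X0") simp_all
      have av: "a + v x \<in> {a..b}" using v_pos[of x] vm by (simp add: m_def)
      obtain d where d: "laplacian_le v x d" "d \<le> C1 * v x" "\<bar>x $ 2\<bar> \<le> l' * x $ 1 \<longrightarrow> d \<le> - c * v x powr p"
        using v_lap[OF vm] by blast
      have "d \<le> deriv W (a + v x) + A (x $ 1) (x $ 2) * v x"
      proof (cases "\<bar>x $ 2\<bar> \<le> l' * x $ 1")
        case True
        have "A (x $ 1) (x $ 2) * v x \<ge> 0" using A_nonneg v_pos[of x] by simp
        moreover have "- c * v x powr p \<le> deriv W (a + v x)" using bspec[OF assms(8) av] by simp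
        ultimately show ?thesis using True d(3) by linarith
      next
        case False
        then have "A (x $ 1) (x $ 2) = C1 + L" using x1 by (intro A_1) auto
        moreover have "- L * v x \<le> deriv W (a + v x)" using W'_La[OF av] by simp
        ultimately show ?thesis using d(2) by (simp add: distrib_right)
      qed
      then show ?thesis using d(1) x1 by blast
    qed simp
    have F_a: "F x a \<le> 0" and F_b: "F x b \<ge> 0" for x
      using A_nonneg assms(2,5,6) by (auto simp: F_def)
    have hi_super: "laplacian_le hi x (F x (hi x))" for x
      using lap[of x]
    proof
      assume "v x = m"
      then have "hi x = b" "\<And>y. hi y \<le> b" using v_le by (auto simp: hi_def m_def add.commute le_diff_eq)
      then show ?thesis using F_b by (intro laplacian_le_const) auto
    next
      assume "\<exists>d. x $ 1 > X0 \<and> laplacian_le v x d \<and> d \<le> deriv W (a + v x) + A (x $ 1) (x $ 2) * v x"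
      then obtain d where d: "x $ 1 > X0" "laplacian_le v x d" "d \<le> deriv W (a + v x) + A (x $ 1) (x $ 2) * v x" by blast
      \<comment> \<open>Where the upper barrier is not capped, \<open>x1 > X0 > 0\<close>, and the
        correction acting on the left is switched off.\<close>
      have "A (- x $ 1) (x $ 2) = 0" using d(1) X0 \<epsilon> by (intro A_0) auto
      then have "d \<le> F x (hi x)" using d(3) by (simp add: F_def hi_def)
      then show ?thesis
        unfolding hi_def using laplacian_le_add_const[OF d(2)] by (rule laplacian_le_mono[rotated])
    qed
    have lo_sub: "laplacian_le (\<lambda>y. - lo y) x (- F x (lo x))" for x
      using lap[of "reflect x"]
    proof
      assume "v (reflect x) = m"
      then have "lo x = a" "\<And>y. lo y \<ge> a" using v_le by (auto simp: lo_def m_def algebra_simps)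
      then show ?thesis using F_a by (intro laplacian_le_const) auto
    next
      let ?y = "reflect x"
      assume "\<exists>d. ?y $ 1 > X0 \<and> laplacian_le v ?y d \<and> d \<le> deriv W (a + v ?y) + A (?y $ 1) (?y $ 2) * v ?y"
      then obtain d where d: "- x $ 1 > X0" "laplacian_le v ?y d" "d \<le> deriv W (a + v ?y) + A (- x $ 1) (x $ 2) * v ?y" by auto
      have v_ab: "a + v ?y \<in> {a..b}" "lo x \<in> {a..b}" using v_pos[of ?y] v_le[of ?y] by (auto simp: m_def lo_def)
      have "A (x $ 1) (x $ 2) = 0" using d(1) X0 \<epsilon> by (intro A_0) auto
      \<comment> \<open>The known bound contains \<open>W'\<close> at \<open>a + v\<close>, the
        required one contains \<open>- W'\<close> at \<open>b - v\<close>. The sign alone connects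
        them: \<open>W' (a + v) \<le> 0 \<le> - W' (b - v)\<close>. The corrections agree because
        \<open>b - lo x\<close> is the reflected \<open>v\<close>.\<close>
      then have "d \<le> - F x (lo x)"
        using d(3) W'_neg[OF v_ab(1)] W'_neg[OF v_ab(2)] by (simp add: F_def lo_def)
      moreover have "(\<lambda>y. - lo y) = (\<lambda>y. - b + v (reflect y))" by (simp add: lo_def fun_eq_iff)
      ultimately show ?thesis
        using laplacian_le_add_const[OF laplacian_le_reflect[OF d(2)], of "- b"]
        by (auto intro: laplacian_le_mono)
    qed

    \<comment> \<open>Existence between the barriers\<close>
    have refl_cont: "continuous_on UNIV reflect"
      unfolding reflect_def
    proof (rule continuous_on_vec_lambda)
      show "continuous_on UNIV (\<lambda>x::real^2. if i = 1 then - x $ 1 else x $ i)" for i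
        by (cases "i = 1") (auto intro!: continuous_intros)
    qed
    \<comment> \<open>The decay of \<open>v\<close>, used with tolerance \<open>m\<close>, gives a
      point where the upper barrier is below \<open>b\<close>; its mirror image serves for the lower
      barrier.\<close>
    obtain M where M: "\<And>x. x $ 1 > M \<Longrightarrow> v x < m" using v_lim[OF m] by blast
    have y: "v (axis 1 (M + 1)) < m" by (rule M) (simp add: axis_def)
    obtain u where u: "C_diff_on 2 UNIV u" "\<And>x. laplacian u x = F x (u x)"
      "\<And>x. lo x \<le> u x" "\<And>x. u x \<le> hi x" "\<And>x. a < u x" "\<And>x. u x < b"
    proof (rule sub_supersolution[where F = F and lo = lo and hi = hi and a = a and b = b and ?w0.0 = w0])
      show "F x a \<le> 0" "F x b \<ge> 0" for x by (rule F_a F_b)+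
      show "a \<le> lo x" "hi x \<le> b" for x
        using v_le[of x] v_le[of "reflect x"] by (auto simp: lo_def hi_def m_def)
      show "continuous_on UNIV lo" "continuous_on UNIV hi"
        unfolding lo_def hi_def
        by (auto intro!: continuous_intros v_cont continuous_on_compose2[OF v_cont refl_cont])
      show "laplacian_le (\<lambda>y. - lo y) x (- F x (lo x))" "laplacian_le hi x (F x (hi x))" for x
        by (rule lo_sub hi_super)+
      show "hi (axis 1 (M + 1)) < b" using y by (simp add: hi_def m_def)
      have "reflect (reflect (axis 1 (M + 1))) = axis 1 (M + 1)" by (simp add: vec_eq_iff forall_2)
      then show "lo (reflect (axis 1 (M + 1))) > a" using y by (simp add: lo_def m_def)
      show "lo x \<le> w0 x" "w0 x \<le> hi x" for x
      proof -
        have "0 \<le> m * max 0 (min 1 (- x $ 1 / X0))" "m * max 0 (min 1 (- x $ 1 / X0)) \<le> m"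
          using m by (auto intro: mult_left_le)
        then have w0_ab: "a \<le> w0 x" "w0 x \<le> b" unfolding w0_def m_def by linarith+
        show "lo x \<le> w0 x"
        proof (cases "- x $ 1 \<le> X0")
          case True
          then have "v (reflect x) = m" by (intro v_m) simp
          then show ?thesis using w0_ab by (simp add: lo_def m_def)
        next
          case False
          then have "- x $ 1 / X0 \<ge> 1" using X0 by (simp add: divide_simps)
          then have "w0 x = b" unfolding w0_def m_def by (simp add: min_absorb1)
          then show ?thesis using v_pos[of "reflect x"] by (simp add: lo_def less_imp_le)
        qed
        show "w0 x \<le> hi x"
        proof (cases "x $ 1 \<le> X0")
          case True
          then have "v x = m" by (intro v_m) simp
          then show ?thesis using w0_ab by (simp add: hi_def m_def)
        next
          case False
          then have "- x $ 1 / X0 \<le> 0" using X0 by (simp add: divide_le_0_iff)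
          then have "w0 x = a" unfolding w0_def by (simp add: max_absorb1 min_def)
          then show ?thesis using v_pos[of x] by (simp add: hi_def less_imp_le)
        qed
      qed
      have comp: "\<bar>x $ i - y $ i\<bar> \<le> norm (x - y)" for x y :: "real^2" and i
        using component_le_norm_cart[of "x - y" i] by simp
      show "\<bar>w0 x - w0 y\<bar> \<le> (m / X0) * norm (x - y)" for x y
      proof -
        have "\<bar>w0 x - w0 y\<bar> = m * \<bar>max 0 (min 1 (- x $ 1 / X0)) - max 0 (min 1 (- y $ 1 / X0))\<bar>"
          using m unfolding w0_def by (simp add: right_diff_distrib[symmetric] abs_mult)
        also have "\<dots> \<le> m * \<bar>- x $ 1 / X0 - - y $ 1 / X0\<bar>"
          using m by (intro mult_left_mono abs_clamp_diff_le) auto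
        also have "\<dots> = (m / X0) * \<bar>x $ 1 - y $ 1\<bar>"
          using X0 by (simp add: diff_divide_distrib[symmetric] abs_divide abs_minus_commute)
        also have "\<dots> \<le> (m / X0) * norm (x - y)" using m X0 by (intro mult_left_mono comp) auto
        finally show ?thesis .
      qed
      have prod_diff: "\<bar>f * s - g * t\<bar> \<le> (C1 + L) * \<bar>s - t\<bar> + K * r * m"
        if "0 \<le> f" "f \<le> C1 + L" "\<bar>f - g\<bar> \<le> K * r" "\<bar>t\<bar> \<le> m" for f g s t r
      proof -
        have "f * s - g * t = f * (s - t) + (f - g) * t" by (simp add: algebra_simps)
        moreover have "\<bar>f * (s - t)\<bar> \<le> (C1 + L) * \<bar>s - t\<bar>"
          using that unfolding abs_mult by (intro mult_right_mono) auto
        moreover have "\<bar>(f - g) * t\<bar> \<le> (K * r) * m"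
          using that unfolding abs_mult by (intro mult_mono) auto
        ultimately show ?thesis by linarith
      qed
      show "\<bar>F x s - F y t\<bar> \<le> (L + 2 * (C1 + L) + 2 * K * m) * (norm (x - y) + \<bar>s - t\<bar>)"
        if st: "s \<in> {a..b}" "t \<in> {a..b}" for x y s t
      proof -
        let ?r = "norm (x - y)"
        have eq: "\<bar>(s - a) - (t - a)\<bar> = \<bar>s - t\<bar>" "\<bar>(b - s) - (b - t)\<bar> = \<bar>s - t\<bar>" by auto
        have tri: "\<bar>w + f - g - (w' + f' - g')\<bar> \<le> \<bar>w - w'\<bar> + \<bar>f - f'\<bar> + \<bar>g - g'\<bar>" for w f g w' f' g' :: real
          by linarith
        have 1: "\<bar>A (x $ 1) (x $ 2) * (s - a) - A (y $ 1) (y $ 2) * (t - a)\<bar> \<le> (C1 + L) * \<bar>(s - a) - (t - a)\<bar> + K * ?r * m"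
          using st comp by (intro prod_diff A_nonneg A_le A_lip) (auto simp: m_def)
        have 2: "\<bar>A (- x $ 1) (x $ 2) * (b - s) - A (- y $ 1) (y $ 2) * (b - t)\<bar> \<le> (C1 + L) * \<bar>(b - s) - (b - t)\<bar> + K * ?r * m"
          using st comp[of x 1 y] comp[of x 2 y]
          by (intro prod_diff A_nonneg A_le A_lip) (auto simp: m_def abs_minus_commute)
        have "\<bar>F x s - F y t\<bar> \<le> L * \<bar>s - t\<bar> + ((C1 + L) * \<bar>s - t\<bar> + K * ?r * m) + ((C1 + L) * \<bar>s - t\<bar> + K * ?r * m)"
          unfolding F_def by (rule order_trans[OF tri add_mono[OF add_mono[OF L(2)[OF st] 1[unfolded eq]] 2[unfolded eq]]])
        moreover have "0 \<le> L * ?r + 2 * ((C1 + L) * ?r) + 2 * (K * \<bar>s - t\<bar> * m)"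
          using L(1) C1 K m by (intro add_nonneg_nonneg mult_nonneg_nonneg) auto
        ultimately show ?thesis by (simp add: algebra_simps)
      qed
      show "\<bar>F x s\<bar> \<le> L * m + 2 * ((C1 + L) * m)" if s: "s \<in> {a..b}" for x s
      proof -
        have "\<bar>deriv W s\<bar> \<le> L * \<bar>s - a\<bar>" using L(2)[OF s, of a] assms(2,5) by simp
        also have "\<dots> \<le> L * m" using s L(1) by (intro mult_left_mono) (auto simp: m_def)
        finally have "\<bar>deriv W s\<bar> \<le> L * m" .
        moreover have "\<bar>A (x $ 1) (x $ 2) * (s - a)\<bar> \<le> (C1 + L) * m"
          "\<bar>A (- x $ 1) (x $ 2) * (b - s)\<bar> \<le> (C1 + L) * m"
          using s A_nonneg A_le C1 L(1) unfolding abs_mult by (auto intro!: mult_mono simp: m_def)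
        ultimately show ?thesis unfolding F_def by linarith
      qed
    qed (rule that)

    \<comment> \<open>Return to the domain and the limits\<close>
    have F_W: "F x s = deriv W s" if "x \<in> profile_domain \<psi>" for x s
    proof -
      have x: "\<bar>x $ 2\<bar> < \<psi> (x $ 1)" using that by (simp add: profile_domain_def)
      have x2: "\<bar>x $ 2\<bar> \<le> l * s" if "s > \<epsilon>" "\<bar>x $ 1\<bar> = s" for s
        using x \<psi> that by auto
      \<comment> \<open>For \<open>x1 > \<epsilon>\<close> the domain is the cone of slope
        \<open>l\<close>, otherwise the first alternative holds. Either one makes \<open>A\<close>
        vanish, and the same reasoning applies to the reflected point.\<close>
      have "x $ 1 \<le> \<epsilon> \<or> \<bar>x $ 2\<bar> \<le> l * x $ 1"
        using x2[of "x $ 1"] \<epsilon> by (cases "x $ 1 \<le> \<epsilon>") auto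
      moreover have "- x $ 1 \<le> \<epsilon> \<or> \<bar>x $ 2\<bar> \<le> l * - x $ 1"
        using x2[of "- x $ 1"] \<epsilon> by (cases "- x $ 1 \<le> \<epsilon>") auto
      ultimately have "A (x $ 1) (x $ 2) = 0" "A (- x $ 1) (x $ 2) = 0"
        by (simp_all only: A_0)
      then show ?thesis by (simp add: F_def)
    qed
    show "\<exists>u :: real ^ 2 \<Rightarrow> real.
       C_diff_on 2 (profile_domain \<psi>) u \<and>
       (\<forall>x\<in>profile_domain \<psi>. laplacian u x = deriv W (u x)) \<and>
       u ` profile_domain \<psi> \<subseteq> {a<..<b} \<and>
       (\<forall>\<eta>>0. \<exists>M. \<forall>x\<in>profile_domain \<psi>. x $ 1 > M \<longrightarrow> \<bar>u x - a\<bar> < \<eta>) \<and>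
       (\<forall>\<eta>>0. \<exists>M. \<forall>x\<in>profile_domain \<psi>. x $ 1 < M \<longrightarrow> \<bar>u x - b\<bar> < \<eta>)"
    proof (intro exI[of _ u] conjI ballI allI impI)
      show "C_diff_on 2 (profile_domain \<psi>) u" using u(1) by (rule C_diff_on_subset) simp
      show "laplacian u x = deriv W (u x)" if "x \<in> profile_domain \<psi>" for x
        using u(2) F_W[OF that] by simp
      show "u ` profile_domain \<psi> \<subseteq> {a<..<b}" using u(5,6) by auto
      fix \<eta> :: real assume "\<eta> > 0"
      \<comment> \<open>The decay of \<open>v\<close> is uniform in \<open>x2\<close>, so one
        \<open>M\<close> serves both limits, since \<open>u - a \<le> v x\<close> and
        \<open>b - u \<le> v (reflect x)\<close>.\<close>
      then obtain M where M: "\<And>x. x $ 1 > M \<Longrightarrow> v x < \<eta>" using v_lim by blast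
      show "\<exists>M. \<forall>x\<in>profile_domain \<psi>. x $ 1 > M \<longrightarrow> \<bar>u x - a\<bar> < \<eta>"
      proof (intro exI[of _ M] ballI impI)
        fix x :: "real^2" assume "x $ 1 > M"
        then show "\<bar>u x - a\<bar> < \<eta>" using M[of x] u(4,5)[of x] by (simp add: hi_def)
      qed
      show "\<exists>M. \<forall>x\<in>profile_domain \<psi>. x $ 1 < M \<longrightarrow> \<bar>u x - b\<bar> < \<eta>"
      proof (intro exI[of _ "- M"] ballI impI)
        fix x :: "real^2" assume "x $ 1 < - M"
        then show "\<bar>u x - b\<bar> < \<eta>" using M[of "reflect x"] u(3,6)[of x] by (simp add: lo_def)
      qed
    qed
  qed
qed

end
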